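(* Let $q=p^f$ be a power of a prime $p$, let $r>1$, and let $\mathbf{s}=(s_1,\ldots,s_r)$ with all $s_i<0$ integers. Then $\zeta(\mathbf{s})=0$ if and only if $\mathbf{s}$ is a trivial zero, i.e. if and only if there exists $1\le i\le r-1$ with $r-i>L_{-s_i}$.
   Context: $\mathbb{F}_q$ is the field with $q=p^f$ elements, $A=\mathbb{F}_q[t]$, $K_\infty=\mathbb{F}_q((1/t))$, $A_{d+}$ is the set of monic polynomials in $A$ of degree $d$, and $S_d(s)=\sum_{a\in A_{d+}}a^{-s}$. For $\mathbf{s}=(s_1,\ldots,s_r)\in\mathbb{Z}^r$, the multizeta value is $\zeta(\mathbf{s})=\sum_{d_1>d_2>\cdots>d_r\ge0}S_{d_1}(s_1)\cdots S_{d_r}(s_r)\in K_\infty$ (for negative $s_i$ only finitely many terms are nonzero). For a positive integer $k$ with base-$q$ expansion $k=a_0+a_1q+\cdots+a_nq^n$, $l(k)=\sum_i a_i$ and $L_k=\min_{0\le i\le f-1} l(kp^i)/(q-1)$. A tuple $\mathbf{s}$ of negative integers with $r>1$ and $\zeta(\mathbf{s})=0$ is called a trivial zero if there is $1\le i\le r-1$ with $r-i>L_{-s_i}$. *)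

theory Defs
  imports "HOL-Analysis.Analysis" "HOL-Computational_Algebra.Computational_Algebra"
begin

text \<open>
  A type \<open>'a\<close> of class \<open>{field, finite}\<close> plays the role of \<open>\<F>\<^sub>q\<close>, \<open>'a poly\<close> that of
  \<open>A = \<F>\<^sub>q[t]\<close>, and \<open>'a fls\<close> that of \<open>K\<^sub>\<infinity> = \<F>\<^sub>q((1/t))\<close>: the variable
  \<^const>\<open>fls_X\<close> stands for \<open>1/t\<close>, so that \<^const>\<open>fls_X_inv\<close> is \<open>t\<close>, and the library metric
  on \<open>'a fls\<close> induces the \<open>1/t\<close>-adic topology.
\<close>

definition poly_to_K_infty :: "'a::field poly \<Rightarrow> 'a fls" where
  "poly_to_K_infty a = poly (map_poly fls_const a) fls_X_inv"

definition monic_of_degree :: "nat \<Rightarrow> 'a::field poly set" where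
  "monic_of_degree d = {a. lead_coeff a = 1 \<and> degree a = d}"

definition power_sum :: "nat \<Rightarrow> int \<Rightarrow> 'a::{field,finite} fls" where
  "power_sum d s = (\<Sum>a\<in>monic_of_degree d. poly_to_K_infty a powi (- s))"

text \<open>
  The tuple \<open>(s\<^sub>1, \<dots>, s\<^sub>r)\<close> is a list, indexed from 0, so \<open>s\<^sub>i\<close> is \<open>s ! (i - 1)\<close>.
\<close>

definition multizeta :: "int list \<Rightarrow> 'a::{field,finite} fls" where
  "multizeta s =
     (\<Sum>\<^sub>\<infinity>d | length d = length s \<and> sorted_wrt (>) d.
        \<Prod>j<length s. power_sum (d ! j) (s ! j))"

text \<open>
  For \<open>q \<ge> 2\<close> one has \<open>k < q ^ i\<close> whenever \<open>i > k\<close>, so the sum below contains all nonzero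
  base-\<open>q\<close> digits of \<open>k\<close>.
\<close>

definition digit_sum :: "nat \<Rightarrow> nat \<Rightarrow> nat" where
  "digit_sum q k = (\<Sum>i\<le>k. k div q ^ i mod q)"

definition L_bound :: "nat \<Rightarrow> nat \<Rightarrow> nat \<Rightarrow> real" where
  "L_bound p f k =
     Min ((\<lambda>i. real (digit_sum (p ^ f) (k * p ^ i)) / (real (p ^ f) - 1)) ` {0..<f})"

text \<open>
  The coefficient field does not occur in the type of \<open>s\<close> and is passed as a type argument.
\<close>

definition trivial_zero :: "'a::{field,finite} itself \<Rightarrow> nat \<Rightarrow> nat \<Rightarrow> int list \<Rightarrow> bool" where
  "trivial_zero _ p f s \<longleftrightarrow>
     length s > 1 \<and> (\<forall>x\<in>set s. x < 0) \<and> (multizeta s :: 'a fls) = 0 \<and>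
     (\<exists>i\<in>{1..length s - 1}. real (length s - i) > L_bound p f (nat (- (s ! (i - 1)))))"

end

theory Submission
  imports Defs
begin

text \<open>
  Expanding \<open>(t b + c)^k\<close> and summing over \<open>c \<in> \<F>\<^sub>q\<close> gives
  \<open>S\<^sub>d\<^sub>+\<^sub>1(-k) = - \<Sum>\<^sub>j (k choose j) t^j S\<^sub>d(-j)\<close>, where \<open>j < k\<close> and \<open>j \<equiv> k\<close> modulo \<open>q - 1\<close>; by Lucas, only those
  \<open>j\<close> matter whose base-\<open>p\<close> digits are dominated by the digits of \<open>k\<close>. Hence \<open>S\<^sub>d(-k)\<close> is a combination of
  monomials \<open>t^(h\<^sub>1 + \<dots> + h\<^sub>d)\<close>, one for each descending chain \<open>k > h\<^sub>1 > \<dots> > h\<^sub>d\<close> of such numbers, and chains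
  exist iff \<open>d \<le> L\<^sub>k\<close>. An exchange argument in the spirit of Sheats shows that the chain with the least
  sum is unique, so its monomial survives. For \<open>d \<ge> 2\<close>, deleting \<open>h\<^sub>1\<close> from a chain decreases its sum; therefore
  the order of vanishing at \<open>t = 0\<close> of \<open>S\<^sub>d(-k)\<close> grows strictly with \<open>d \<ge> 1\<close>, and if all \<open>S\<^sub>r\<^sub>-\<^sub>i(s\<^sub>i)\<close> are nonzero, the
  lowest power of \<open>t\<close> in the multizeta value comes from the single tuple \<open>(r - 1, \<dots>, 1, 0)\<close>. If one of
  them vanishes, every term of the multizeta value does, as \<open>d\<^sub>i \<ge> r - i\<close>.
\<close>

section \<open>Digit multisets and their weights\<close>

text \<open>The obstacle is that \<open>q\<close> need not be prime. For \<open>f = 1\<close> all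
  weights are 1 and a single inequality governs everything. For \<open>f > 1\<close> a set of digits
  can be heavy enough for one \<open>l(k p^i)\<close> and too light for another, and a swap that
  lowers the sum may spoil the bound at a different \<open>i\<close>. Every bound is therefore
  carried for all rotations \<open>s\<close> at once, and digits with prescribed weights are found
  by solving \<open>cnt s = p x_s - x_(s+1)\<close> for a vector of carries \<open>x\<close>.
  Uniqueness rests on a property of the top alone: in a chain of least sum, \<open>h_1\<close> is
  the smallest number whose digits come from those of \<open>k\<close> and whose weights suffice for
  the rest of the chain. This determines \<open>h_1\<close>; the later members are settled by
  induction on \<open>d\<close> in the recursion for the coefficients. The least exponent then
  carries, up to sign, a product of binomial coefficients that are nonzero modulo \<open>p\<close>,
  with nothing left to cancel it.\<close>

text \<open>
  A multiset \<open>M\<close> of digit positions stands for the number \<open>val p M\<close>. If \<open>M\<close> consists of the base-\<open>p\<close>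
  digits of \<open>k\<close>, then \<open>lv p f s M\<close> is the base-\<open>q\<close> digit sum \<open>l(k p^s)\<close>; since only the residue of \<open>s\<close>
  modulo \<open>f\<close> matters, \<open>s\<close> may be any integer. \<open>cnt p f s M\<close> counts the positions whose weight drops
  from \<open>q/p\<close> to \<open>1\<close> when \<open>s\<close> becomes \<open>s + 1\<close>.
\<close>

definition val :: "nat \<Rightarrow> nat multiset \<Rightarrow> nat" where
  "val p M = (\<Sum>e\<in>#M. p ^ e)"

definition wt :: "nat \<Rightarrow> nat \<Rightarrow> int \<Rightarrow> nat \<Rightarrow> int" where
  "wt p f s e = int p ^ nat ((int e + s) mod int f)"

definition lv :: "nat \<Rightarrow> nat \<Rightarrow> int \<Rightarrow> nat multiset \<Rightarrow> int" where
  "lv p f s M = (\<Sum>e\<in>#M. wt p f s e)"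

definition cnt :: "nat \<Rightarrow> nat \<Rightarrow> int \<Rightarrow> nat multiset \<Rightarrow> int" where
  "cnt p f s M = int (size {#e \<in># M. wt p f (s + 1) e = 1#})"

lemma val_simps [simp]:
  "val p {#} = 0" "val p (add_mset e M) = p ^ e + val p M" "val p (M + N) = val p M + val p N"
  by (auto simp: val_def)

lemma lv_simps [simp]:
  "lv p f s {#} = 0" "lv p f s (add_mset e M) = wt p f s e + lv p f s M"
  "lv p f s (M + N) = lv p f s M + lv p f s N"
  by (auto simp: lv_def)

lemma cnt_simps [simp]:
  "cnt p f s {#} = 0" 
  "cnt p f s (add_mset e M) = (if wt p f (s + 1) e = 1 then 1 else 0) + cnt p f s M"
  "cnt p f s (M + N) = cnt p f s M + cnt p f s N"
  by (auto simp: cnt_def)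

lemma lv_diff [simp]: "N \<subseteq># M \<Longrightarrow> lv p f s (M - N) = lv p f s M - lv p f s N"
  by (metis add_diff_cancel_right' subset_mset.diff_add lv_simps(3))

lemma cnt_diff: "N \<subseteq># M \<Longrightarrow> cnt p f s (M - N) = cnt p f s M - cnt p f s N"
  by (metis add_diff_cancel_right' subset_mset.diff_add cnt_simps(3))

lemma val_mono: "N \<subseteq># M \<Longrightarrow> val p N \<le> val p M"
  by (metis le_add2 subset_mset.diff_add val_simps(3))

lemma cnt_nonneg: "cnt p f s M \<ge> 0"
  by (simp add: cnt_def)

lemma cnt_mono: "N \<subseteq># M \<Longrightarrow> cnt p f s N \<le> cnt p f s M"
  by (metis cnt_diff cnt_nonneg diff_ge_0_iff_ge)

locale base_pow =
  fixes p f :: nat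
  assumes p2: "2 \<le> p" and f0: "0 < f"
begin

abbreviation "w \<equiv> wt p f"
abbreviation "l \<equiv> lv p f"
abbreviation "c \<equiv> cnt p f"
abbreviation "N \<equiv> val p"

definition Q :: int where "Q = int p ^ f - 1"

lemma p_ge: "int p \<ge> 2" using p2 by simp

lemma pow_eq_1 [simp]: "int p ^ n = 1 \<longleftrightarrow> n = 0"
proof
  assume "int p ^ n = 1"
  then show "n = 0" using p_ge one_less_power[of "int p" n] by (cases "n = 0") auto
qed simp

lemma Q_pos: "Q \<ge> 1"
proof -
  have "int p ^ 1 \<le> int p ^ f" using p2 f0 by (intro power_increasing) auto
  then have "int p \<le> int p ^ f" by simp
  then show ?thesis using p_ge unfolding Q_def by linarith
qed

lemma w_pos: "w s e \<ge> 1"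
  using p2 by (simp add: wt_def)

text \<open>A weight is at most \<open>q / p\<close>, which is at most \<open>q - 1\<close>. Hence
  deleting one element lowers \<open>lv\<close> by at most one \<open>Q\<close>, the slack that is
  traded throughout.\<close>

lemma w_le: "w s e \<le> Q"
proof -
  have "(int e + s) mod int f < int f" using f0 by simp
  then have "nat ((int e + s) mod int f) \<le> f - 1" using f0 by linarith
  then have "w s e \<le> int p ^ (f - 1)" unfolding wt_def using p2 by (intro power_increasing) auto
  moreover have "int p ^ f = int p * int p ^ (f - 1)" using f0 by (metis power_eq_if not_gr0)
  moreover have "int p * int p ^ (f - 1) \<ge> 2 * int p ^ (f - 1)" using p_ge by (intro mult_right_mono) auto
  moreover have "int p ^ (f - 1) \<ge> 1" using p2 by simp
  ultimately show ?thesis unfolding Q_def by linarith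
qed

lemma w_periodic [simp]: "w (s + int f) e = w s e"
  by (simp add: wt_def add.assoc[symmetric])

lemma l_periodic [simp]: "l (s + int f) M = l s M"
  by (induction M) auto

lemma c_periodic [simp]: "c (s + int f) M = c s M"
proof -
  have "w (s + int f + 1) e = w (s + 1) e" for e
    using w_periodic[of "s + 1" e] by (simp add: algebra_simps)
  then show ?thesis by (simp add: cnt_def)
qed

lemma w_eq_1: "w s e = 1 \<longleftrightarrow> (int e + s) mod int f = 0"
proof -
  have "(int e + s) mod int f \<ge> 0" using f0 by simp
  then show ?thesis by (auto simp: wt_def)
qed

text \<open>A step from \<open>s\<close> to \<open>s + 1\<close> multiplies a weight by
  \<open>p\<close>, except that \<open>q / p\<close> wraps round to 1 instead of \<open>q\<close>;
  the defect is \<open>Q\<close>. Summed over a multiset this is the carry equation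
  \<open>l_step\<close>.\<close>

lemma w_step: "w (s + 1) e + (if w (s + 1) e = 1 then Q else 0) = int p * w s e"
proof -
  let ?r = "(int e + s) mod int f"
  have r: "0 \<le> ?r" "?r < int f" using f0 by auto
  have eq: "(int e + (s + 1)) mod int f = (?r + 1) mod int f" 
    by (simp add: mod_simps add.assoc)
  show ?thesis
  proof (cases "?r + 1 = int f")
    case True
    then have "w (s + 1) e = 1" using eq by (simp add: w_eq_1)
    moreover have "nat ?r + 1 = f" using True r by linarith
    moreover have "int p * w s e = int p ^ (nat ?r + 1)" by (simp add: wt_def)
    ultimately have "int p * w s e = int p ^ f" "w (s + 1) e = 1" by simp_all
    then show ?thesis by (simp add: Q_def)
  next
    case False
    then have "(?r + 1) mod int f = ?r + 1" using r by (intro mod_pos_pos_trivial) auto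
    then have e1: "(int e + (s + 1)) mod int f = ?r + 1" using eq by simp
    then have "w (s + 1) e \<noteq> 1" using r w_eq_1 by simp
    moreover have "w (s + 1) e = int p * w s e" unfolding wt_def e1
      using r by (simp add: nat_add_distrib)
    ultimately show ?thesis by simp
  qed
qed

lemma l_step: "l (s + 1) M = int p * l s M - Q * c s M"
proof (induction M)
  case (add e M)
  show ?case using w_step[of s e] add by (auto simp: algebra_simps split: if_splits)
qed simp

lemma l_nonneg: "l s M \<ge> 0"
proof (induction M)
  case (add e M) then show ?case using w_pos[of s e] by simp
qed simp

lemma l_pos: "M \<noteq> {#} \<Longrightarrow> l s M > 0"
proof -
  assume "M \<noteq> {#}"
  then obtain e M' where "M = add_mset e M'" by (meson multiset_cases)
  then show ?thesis using w_pos[of s e] l_nonneg[of s M'] by simp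
qed

lemma l_mono: "A \<subseteq># B \<Longrightarrow> l s A \<le> l s B"
  by (metis l_nonneg lv_diff diff_ge_0_iff_ge)

lemma l_mem: "e \<in># M \<Longrightarrow> w s e \<le> l s M"
  by (metis add.commute l_nonneg le_add_same_cancel1 lv_simps(2) multi_member_split)

section \<open>Periodic functions of the index, and multisets with prescribed weights\<close>

lemma periodic_nat:
  assumes "\<And>s::int. g (s + int f) = g s" shows "g (s + int f * int n) = g s"
proof (induction n)
  case (Suc n) 
  have "s + int f * int (Suc n) = (s + int f * int n) + int f" by (simp add: algebra_simps)
  then show ?case using Suc assms by metis
qed simp

lemma periodic_mod:
  assumes "\<And>s::int. g (s + int f) = g s" and "s mod int f = s' mod int f" shows "g s = g s'"
proof -
  have *: "g a = g b" if "a mod int f = b mod int f" "a \<le> b" for a b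
  proof -
    have "int f dvd b - a" using that(1) by (metis mod_eq_dvd_iff)
    then obtain k where "b - a = int f * k" by (elim dvdE)
    then have k: "b = a + int f * k" by simp
    have "k \<ge> 0" using that k f0 by (simp add: zero_le_mult_iff)
    then have "b = a + int f * int (nat k)" using k by simp
    then show ?thesis using periodic_nat[of g a "nat k", OF assms(1)] by simp
  qed
  show ?thesis
  proof (cases "s \<le> s'")
    case True then show ?thesis using *[OF assms(2)] by blast
  next
    case False then show ?thesis using *[OF assms(2)[symmetric]] by simp
  qed
qed

text \<open>One full period multiplies \<open>E\<close> by \<open>q\<close> and also fixes it, so
  \<open>(q - 1) E = 0\<close>. This turns a matching of the counts \<open>cnt\<close> into an
  equation between weights \<open>lv\<close>: the error of such an equation is periodic and grows by
  the factor \<open>p\<close>.\<close>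

lemma geometric_periodic_zero:
  fixes E :: "int \<Rightarrow> int"
  assumes "\<And>s. E (s + int f) = E s" "\<And>s. E (s + 1) = int p * E s"
  shows "E s = 0"
proof -
  have "E (s + int n) = int p ^ n * E s" for n
  proof (induction n)
    case (Suc n) then show ?case using assms(2)[of "s + int n"] by (simp add: algebra_simps)
  qed simp
  from this[of f] have "E s * Q = 0" using assms(1) by (simp add: Q_def algebra_simps)
  then show ?thesis using Q_pos by simp
qed

text \<open>The elements counted by \<open>cnt p f s\<close> form one residue class of positions
  modulo \<open>f\<close>, and different classes are disjoint. So the counts can be prescribed
  independently, by deleting surplus elements class by class.\<close>

lemma select_types:
  fixes n :: "int \<Rightarrow> int"
  assumes "\<And>s. n (s + int f) = n s" "\<And>s. 0 \<le> n s" "\<And>s. n s \<le> c s M"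
  shows "\<exists>G. G \<subseteq># M \<and> (\<forall>s. c s G = n s)"
  using assms(3)
proof (induction M rule: measure_induct_rule[of size])
  case (less M)
  show ?case
  proof (cases "\<forall>s. c s M = n s")
    case True then show ?thesis by auto
  next
    case False
    then obtain s where s: "n s < c s M" using less.prems by (metis order.order_iff_strict)
    then have "c s M > 0" using assms(2)[of s] by linarith
    then have "0 < size {#e \<in># M. w (s + 1) e = 1#}" by (simp add: cnt_def)
    then obtain e where "e \<in># {#e \<in># M. w (s + 1) e = 1#}" by (metis nonempty_has_size multiset_nonemptyE)
    then have e: "e \<in># M" "w (s + 1) e = 1" by auto
    have "n s' \<le> c s' (M - {#e#})" for s'
    proof (cases "w (s' + 1) e = 1")
      case True
      then have "int f dvd (int e + (s' + 1)) - (int e + (s + 1))" 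
        using e(2) by (intro dvd_diff) (auto simp: w_eq_1)
      then have "s' mod int f = s mod int f" by (simp add: mod_eq_dvd_iff)
      then have "n s' = n s" "c s' M = c s M" 
        using periodic_mod[of n s' s] periodic_mod[of "\<lambda>s. c s M" s' s] assms(1) by auto
      then show ?thesis using s e(1) True by (simp add: cnt_diff)
    next
      case False then show ?thesis using less.prems e(1) by (simp add: cnt_diff)
    qed
    moreover have "size (M - {#e#}) < size M" using e(1) by (simp add: size_Diff1_less)
    ultimately obtain G where "G \<subseteq># M - {#e#}" "\<forall>s. c s G = n s" using less.IH by blast
    then show ?thesis by (meson diff_subset_eq_self subset_mset.order_trans)
  qed
qed

text \<open>
  A vector \<open>x\<close> of carries with \<open>cnt s M = p x\<^sub>s - x\<^sub>s\<^sub>+\<^sub>1\<close> for all \<open>s\<close> encodes that \<open>lv s M = (q - 1) x\<^sub>s\<close>.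
  The constraints on such vectors are closed under pointwise minima, so least solutions exist.
\<close>

lemma least_carry:
  fixes b y :: "int \<Rightarrow> nat" and k :: "int \<Rightarrow> int"
  assumes "\<And>s. b (s + int f) = b s" "\<And>s. k (s + int f) = k s"
    and by': "\<And>s. b s \<le> y s" and y: "\<And>s. int p * int (y s) - k s \<le> int (y (s + 1))"
  shows "\<exists>x. (\<forall>s. x (s + int f) = x s) \<and> (\<forall>s. b s \<le> x s \<and> x s \<le> y s) \<and> 
    (\<forall>s. x (s + 1) = max (b (s + 1)) (nat (int p * int (x s) - k s)))"
proof -
  \<comment> \<open>Periodicity is not imposed on the members, so that one can be lowered at a
    single index; the minimum is periodic because \<open>X\<close> is closed under shifts by
    \<open>f\<close> in both directions.\<close>
  define X where "X = {x :: int \<Rightarrow> nat. \<forall>s. b s \<le> x s \<and> int p * int (x s) - k s \<le> int (x (s + 1))}"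
  define x where "x s = Inf ((\<lambda>x. x s) ` X)" for s
  have yX: "y \<in> X" using by' y by (auto simp: X_def)
  have le: "x s \<le> g s" if "g \<in> X" for g s
    unfolding x_def using that by (intro cInf_lower) auto
  have att: "\<exists>g\<in>X. x s = g s" for s
  proof -
    have "x s \<in> (\<lambda>x. x s) ` X" unfolding x_def using yX by (intro Inf_nat_def1) auto
    then show ?thesis by auto
  qed
  have xX: "x \<in> X" unfolding X_def
  proof (intro CollectI allI conjI)
    fix s
    show "b s \<le> x s" using att[of s] by (auto simp: X_def)
    obtain g where g: "g \<in> X" "x (s + 1) = g (s + 1)" using att by blast
    have "int p * int (x s) \<le> int p * int (g s)" using le[OF g(1)] by (intro mult_left_mono) auto
    then show "int p * int (x s) - k s \<le> int (x (s + 1))" using g by (auto simp: X_def) (smt (verit))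
  qed
  have per: "x (s + int f) = x s" for s
  proof (rule antisym)
    have "b (s - int f) = b s" for s using assms(1)[of "s - int f"] by simp
    moreover have "k (s - int f) = k s" for s using assms(2)[of "s - int f"] by simp
    ultimately have "(\<lambda>s. x (s - int f)) \<in> X" using xX unfolding X_def mem_Collect_eq
      by (metis add_diff_eq add.commute)
    from le[OF this, of "s + int f"] show "x (s + int f) \<le> x s" by simp
    have "(\<lambda>s. x (s + int f)) \<in> X" using xX assms unfolding X_def mem_Collect_eq
      by (metis add.assoc add.commute)
    from le[OF this, of s] show "x s \<le> x (s + int f)" by simp
  qed
  have "x (s + 1) = max (b (s + 1)) (nat (int p * int (x s) - k s))" for s
  proof (rule antisym)
    let ?m = "max (b (s + 1)) (nat (int p * int (x s) - k s))"
    have "int p * int (x s) - k s \<le> int (x (s + 1))" "b (s + 1) \<le> x (s + 1)" using xX unfolding X_def by blast+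
    then have ge: "?m \<le> x (s + 1)" by simp
    then show "?m \<le> x (s + 1)" .
    show "x (s + 1) \<le> ?m"
    proof (rule ccontr)
      assume a: "\<not> ?thesis"
      define g where "g = x (s + 1 := ?m)"
      have "g \<in> X" unfolding X_def
      proof (intro CollectI allI conjI)
        fix u
        show "b u \<le> g u" using xX by (auto simp: g_def X_def)
        have 1: "int p * int (g u) - k u \<le> int p * int (x u) - k u"
          using ge by (auto simp: g_def intro!: mult_left_mono)
        show "int p * int (g u) - k u \<le> int (g (u + 1))"
        proof (cases "u = s")
          case True
          then show ?thesis using 1 by (simp add: g_def)
        next
          case False
          then have "g (u + 1) = x (u + 1)" by (simp add: g_def)
          then show ?thesis using 1 xX unfolding X_def by (smt (verit) mem_Collect_eq)
        qed
      qed
      from le[OF this, of "s + 1"] show False using a by (simp add: g_def)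
    qed
  qed
  then show ?thesis using per xX le[OF yX] by (intro exI[of _ x]) (auto simp: X_def)
qed

section \<open>Comparison of values by the highest differing digit\<close>

lemma val_low:
  assumes "\<And>e. count M e < p" "\<And>e. e \<in># M \<Longrightarrow> e < n"
  shows "N M < p ^ n"
  using assms
proof (induction n arbitrary: M)
  case 0
  then have "M = {#}" by (meson less_nat_zero_code multiset_nonemptyE)
  then show ?case by simp
next
  case (Suc n)
  let ?L = "{#e \<in># M. e < n#}"
  have M: "M = ?L + replicate_mset (count M n) n"
  proof (rule multiset_eqI)
    fix e show "count M e = count (?L + replicate_mset (count M n) n) e"
      using Suc.prems(2)[of e] by (cases "e < n"; cases "e = n") (fastforce simp: not_in_iff)+
  qed
  have "N ?L < p ^ n"
  proof (rule Suc.IH)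
    show "count ?L e < p" for e using Suc.prems(1)[of e] by simp
  qed auto
  moreover have rep: "N (replicate_mset m n) = m * p ^ n" for m by (induction m) auto
  moreover have "count M n * p ^ n \<le> (p - 1) * p ^ n" using Suc.prems(1)[of n] by (intro mult_right_mono) auto
  moreover have "p ^ Suc n = (p - 1) * p ^ n + p ^ n" using p2 by (cases p) auto
  moreover have "N M = N ?L + N (replicate_mset (count M n) n)" by (metis M val_simps(3))
  ultimately show ?case unfolding rep by linarith
qed

lemma val_less:
  assumes M: "\<And>e. count M e < p" and top: "\<And>e'. e < e' \<Longrightarrow> count M e' = count M' e'"
    and less: "count M e < count M' e"
  shows "N M < N M'"
proof -
  let ?H = "{#x \<in># M'. e < x#}" and ?L = "{#x \<in># M. x < e#}"
  have 1: "M = ?H + (replicate_mset (count M e) e + ?L)"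
  proof (rule multiset_eqI)
    fix x show "count M x = count (?H + (replicate_mset (count M e) e + ?L)) x"
      using top[of x] by (cases "x < e"; cases "x = e") auto
  qed
  have "?H + (replicate_mset (count M e) e + {#e#}) \<subseteq># M'"
  proof (rule mset_subset_eqI)
    fix x show "count (?H + (replicate_mset (count M e) e + {#e#})) x \<le> count M' x"
      using less by (cases "x < e"; cases "x = e") auto
  qed
  from val_mono[OF this, of p] have 2: "N ?H + N (replicate_mset (count M e) e) + p ^ e \<le> N M'" by simp
  have "N ?L < p ^ e" by (rule val_low) (use M p2 in \<open>auto split: if_splits\<close>)
  then show ?thesis using 2 by (subst 1) simp
qed

lemma val_less_top:
  assumes M: "\<And>e. count M e < p" and M': "\<And>e. count M' e < p" and less: "N M < N M'"
  obtains e where "count M e < count M' e" "\<And>e'. e < e' \<Longrightarrow> count M e' = count M' e'"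
proof -
  let ?D = "{e. count M e \<noteq> count M' e}"
  have fin: "finite ?D" by (rule finite_subset[of _ "set_mset M \<union> set_mset M'"]) (auto simp: not_in_iff)
  have "?D \<noteq> {}" using less by (metis (mono_tags, lifting) empty_Collect_eq less_irrefl multiset_eq_iff)
  then have mem: "Max ?D \<in> ?D" using fin Max_in by blast
  have top: "count M e' = count M' e'" if "Max ?D < e'" for e'
    using Max_ge[OF fin, of e'] that by fastforce
  have "count M (Max ?D) < count M' (Max ?D)"
  proof (rule ccontr)
    assume "\<not> ?thesis"
    then have "count M' (Max ?D) < count M (Max ?D)" using mem by force
    then have "N M' < N M" using val_less[OF M' top[symmetric]] by blast
    then show False using less by simp
  qed
  then show thesis using that top by blast
qed

lemma val_inj:
  assumes "\<And>e. count M e < p" "\<And>e. count M' e < p" "N M = N M'"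
  shows "M = M'"
proof (rule ccontr)
  assume "M \<noteq> M'"
  let ?D = "{e. count M e \<noteq> count M' e}"
  have fin: "finite ?D" by (rule finite_subset[of _ "set_mset M \<union> set_mset M'"]) (auto simp: not_in_iff)
  have "?D \<noteq> {}" using \<open>M \<noteq> M'\<close> by (auto simp: multiset_eq_iff)
  then have mem: "Max ?D \<in> ?D" using fin Max_in by blast
  have top: "count M e' = count M' e'" if "Max ?D < e'" for e'
    using Max_ge[OF fin, of e'] that by fastforce
  have "N M < N M' \<or> N M' < N M"
  proof (cases "count M (Max ?D) < count M' (Max ?D)")
    case True
    then show ?thesis using val_less[OF assms(1) top] by blast
  next
    case False
    then have "count M' (Max ?D) < count M (Max ?D)" using mem by force
    then show ?thesis using val_less[OF assms(2) top[symmetric]] by blast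
  qed
  then show False using assms(3) by simp
qed

text \<open>
  The residues modulo \<open>q - 1\<close> of the digit sums \<open>lv s K\<close> form such a family \<open>\<theta>\<close>; the constant families
  \<open>0\<close> and \<open>q - 1\<close> are the ones needed for multisets whose value is divisible by \<open>q - 1\<close>.
\<close>

definition residual :: "(int \<Rightarrow> int) \<Rightarrow> bool" where
  "residual \<theta> \<longleftrightarrow> (\<forall>s. \<theta> (s + int f) = \<theta> s \<and> 0 \<le> \<theta> s \<and> Q dvd int p * \<theta> s - \<theta> (s + 1) \<and> \<theta> (s + 1) \<le> int p * \<theta> s)"

lemma residual_mod: "residual (\<lambda>s. l s K mod Q)"
proof -
  have eq: "l (s + 1) K mod Q = (int p * (l s K mod Q)) mod Q" for s
  proof -
    have "l (s + 1) K mod Q = (int p * l s K) mod Q"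
      by (simp add: l_step mod_eq_dvd_iff)
    then show ?thesis by (simp add: mod_simps)
  qed
  have "0 \<le> int p * (l s K mod Q)" for s using Q_pos by simp
  then show ?thesis unfolding residual_def eq using Q_pos
    by (auto simp: zmod_le_nonneg_dividend minus_mod_eq_mult_div)
qed

lemma residual_const: "residual (\<lambda>s. 0)" "residual (\<lambda>s. Q)"
  using Q_pos p_ge by (auto simp: residual_def)

lemma dvd_gap: "Q dvd a - b \<Longrightarrow> b < a \<Longrightarrow> b + Q \<le> a"
  using zdvd_imp_le[of Q "a - b"] by simp

lemma le_div_Q: "a * Q \<le> b \<Longrightarrow> a \<le> b div Q"
  using zdiv_mono1[of "a * Q" b Q] Q_pos by simp

text \<open>The result has the form \<open>l s G = \<theta> s + Q x_s\<close> with
  \<open>x_s \<ge> i\<close>, which by \<open>l_step\<close> prescribes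
  \<open>t s + p x_s - x_(s+1)\<close> elements of type \<open>s\<close>. Feasibility of
  \<open>x\<close> keeps these counts below those of \<open>B\<close>, and minimality of
  \<open>x\<close> keeps them nonnegative; a feasible vector is
  \<open>(l s B - \<theta> s) div Q\<close>.\<close>

lemma ex_residual_sub:
  assumes \<theta>: "residual \<theta>" and B: "\<And>s. \<theta> s + int i * Q \<le> l s B"
  shows "\<exists>G. G \<subseteq># B \<and> (\<forall>s. Q dvd l s G - \<theta> s \<and> \<theta> s + int i * Q \<le> l s G)"
proof -
  note \<theta>' = \<theta>[unfolded residual_def, rule_format]
  \<comment> \<open>By \<open>l_step\<close>, the number of elements of type \<open>s\<close> in a
    multiset with weights exactly \<open>\<theta>\<close>.\<close>
  define t where "t s = (int p * \<theta> s - \<theta> (s + 1)) div Q" for s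
  have t: "Q * t s = int p * \<theta> s - \<theta> (s + 1)" for s using \<theta>'[of s] by (simp add: t_def)
  have "0 \<le> Q * t s" for s using t[of s] \<theta>'[of s] by simp
  then have t0: "0 \<le> t s" for s using Q_pos by (simp add: zero_le_mult_iff)
  have tper: "t (s + int f) = t s" for s
    using \<theta>'[of s] \<theta>'[of "s + 1"] by (simp add: t_def algebra_simps)
  define y where "y s = nat ((l s B - \<theta> s) div Q)" for s
  have idiv: "int i \<le> (l s B - \<theta> s) div Q" for s
    using B[of s] by (intro le_div_Q) linarith
  have inty: "int (y s) = (l s B - \<theta> s) div Q" for s
    using idiv[of s] by (simp add: y_def)
  have Qy: "int (y s) * Q \<le> l s B - \<theta> s" for s
    unfolding inty using Q_pos by (simp flip: minus_mod_eq_div_mult)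
  have "\<exists>x. (\<forall>s. x (s + int f) = x s) \<and> (\<forall>s. i \<le> x s \<and> x s \<le> y s) \<and> 
    (\<forall>s. x (s + 1) = max i (nat (int p * int (x s) - (c s B - t s))))"
  proof (rule least_carry)
    fix s
    show "c (s + int f) B - t (s + int f) = c s B - t s" by (simp add: tper)
    show "i \<le> y s" using idiv[of s] by (simp add: y_def)
    have "(int p * int (y s) - (c s B - t s)) * Q = int p * (int (y s) * Q) - Q * c s B + Q * t s"
      by (simp add: algebra_simps)
    also have "\<dots> \<le> int p * (l s B - \<theta> s) - Q * c s B + Q * t s"
      using Qy[of s] by (simp add: mult_left_mono)
    also have "\<dots> = l (s + 1) B - \<theta> (s + 1)" unfolding l_step right_diff_distrib t by simp
    finally show "int p * int (y s) - (c s B - t s) \<le> int (y (s + 1))"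
      unfolding inty by (rule le_div_Q)
  qed simp
  then obtain x where xper: "\<And>s. x (s + int f) = x s" and xb: "\<And>s. i \<le> x s" 
    and xs: "\<And>s. x (s + 1) = max i (nat (int p * int (x s) - (c s B - t s)))" by blast
  have "\<exists>G. G \<subseteq># B \<and> (\<forall>s. c s G = t s + int p * int (x s) - int (x (s + 1)))"
  proof (rule select_types)
    fix s
    show "t (s + int f) + int p * int (x (s + int f)) - int (x (s + int f + 1)) = t s + int p * int (x s) - int (x (s + 1))"
      using xper[of "s + 1"] by (simp add: tper xper algebra_simps)
    have "int i \<le> int p * int (x s)" using xb[of s] p_ge mult_mono[of 1 "int p" "int i" "int (x s)"] by simp
    then show "0 \<le> t s + int p * int (x s) - int (x (s + 1))"
      using xs[of s] t0[of s] cnt_nonneg[of p f s B] by (auto simp: max_def nat_le_iff)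
    show "t s + int p * int (x s) - int (x (s + 1)) \<le> c s B" using xs[of s] by linarith
  qed
  then obtain G where G: "G \<subseteq># B" "\<And>s. c s G = t s + int p * int (x s) - int (x (s + 1))" by blast
  have "l s G - \<theta> s - Q * int (x s) = 0" for s
  proof (rule geometric_periodic_zero[where E = "\<lambda>s. l s G - \<theta> s - Q * int (x s)"])
    fix s
    show "l (s + int f) G - \<theta> (s + int f) - Q * int (x (s + int f)) = l s G - \<theta> s - Q * int (x s)"
      using \<theta>'[of s] by (simp add: xper)
    show "l (s + 1) G - \<theta> (s + 1) - Q * int (x (s + 1)) = int p * (l s G - \<theta> s - Q * int (x s))"
      unfolding l_step G(2) using t[of s] by (simp add: algebra_simps)
  qed
  then have lG: "l s G = \<theta> s + Q * int (x s)" for s by (simp add: algebra_simps)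
  have "int i * Q \<le> Q * int (x s)" for s using xb[of s] Q_pos by (simp add: mult.commute mult_right_mono)
  then show ?thesis using G(1) lG by (intro exI[of _ G]) auto
qed

text \<open>
  Swapping \<open>Y \<subseteq> A\<close> for \<open>X \<subseteq> V\<close> moves a least vector of carries from \<open>A\<close> to \<open>V\<close>, so that \<open>V\<close> takes
  over whatever surplus \<open>A\<close> has at the indices in \<open>Bad\<close>. Since the vector is least, \<open>X\<close> has at most one
  element of each type, and \<open>H\<close> allows it to be chosen low.
\<close>

lemma shift_step:
  assumes \<phi>: "residual \<phi>" and A: "\<And>s. Q dvd l s A - \<phi> s" "\<And>s. \<phi> s \<le> l s A"
    and V: "\<And>s. Q dvd l s V" "\<And>s. Q \<le> l s V"
    and Bper: "\<And>s. Bad (s + int f) = Bad s"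
    and H: "\<And>s. Bad s \<Longrightarrow> l s V = Q \<Longrightarrow> \<phi> s + Q \<le> l s A \<Longrightarrow> 
        (\<exists>x\<in>#V. lo x \<and> w s x = 1) \<or> (Bad (s - 1) \<and> l (s - 1) V = Q \<and> \<phi> (s - 1) + Q \<le> l (s - 1) A)"
  shows "\<exists>X Y. X \<subseteq># filter_mset lo V \<and> Y \<subseteq># A \<and> 
     (\<forall>s. Q dvd l s A - l s Y + l s X - \<phi> s \<and> \<phi> s \<le> l s A - l s Y + l s X) \<and>
     (\<forall>s. Q dvd l s V - l s X + l s Y \<and> Q \<le> l s V - l s X + l s Y) \<and>
     (\<forall>s. Bad s \<and> (2 * Q \<le> l s V \<or> \<phi> s + Q \<le> l s A) \<longrightarrow> 2 * Q \<le> l s V - l s X + l s Y)"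
proof -
  note \<phi>' = \<phi>[unfolded residual_def, rule_format]
  \<comment> \<open>The indices at which \<open>V\<close> weighs only one \<open>Q\<close> and has
    to receive another one from \<open>A\<close>.\<close>
  define T where "T s \<longleftrightarrow> Bad s \<and> l s V = Q \<and> \<phi> s + Q \<le> l s A" for s
  have Tper: "T (s + int f) = T s" for s using \<phi>'[of s] by (simp add: T_def Bper)
  define y where "y s = nat ((l s A - \<phi> s) div Q)" for s
  have inty: "int (y s) = (l s A - \<phi> s) div Q" for s
    using A(2)[of s] Q_pos by (simp add: y_def pos_imp_zdiv_nonneg_iff)
  have Qy: "int (y s) * Q = l s A - \<phi> s" for s
    unfolding inty using A(1)[of s] by simp
  have "\<exists>x. (\<forall>s. x (s + int f) = x s) \<and> (\<forall>s. of_bool (T s) \<le> x s \<and> x s \<le> y s) \<and> 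
    (\<forall>s. x (s + 1) = max (of_bool (T (s + 1))) (nat (int p * int (x s) - c s A)))"
  proof (rule least_carry)
    fix s
    show "of_bool (T (s + int f)) = (of_bool (T s) :: nat)" by (simp add: Tper)
    show "of_bool (T s) \<le> y s"
    proof (cases "T s")
      case True
      then have "1 * Q \<le> int (y s) * Q" using Qy[of s] by (simp add: T_def)
      then have "1 \<le> int (y s)" using Q_pos by (metis mult_le_cancel_right not_less order_less_le_trans zero_less_one)
      then show ?thesis by simp
    qed simp
    have "(int p * int (y s) - c s A) * Q = int p * (int (y s) * Q) - Q * c s A"
      by (simp add: algebra_simps)
    also have "\<dots> = int p * (l s A - \<phi> s) - Q * c s A" by (simp only: Qy)
    also have "\<dots> \<le> l (s + 1) A - \<phi> (s + 1)" unfolding l_step right_diff_distrib using \<phi>'[of s] by simp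
    finally show "int p * int (y s) - c s A \<le> int (y (s + 1))"
      unfolding inty by (rule le_div_Q)
  qed simp
  then obtain x where xper: "\<And>s. x (s + int f) = x s" and xb: "\<And>s. of_bool (T s) \<le> x s" and xy: "\<And>s. x s \<le> y s"
    and xs: "\<And>s. x (s + 1) = max (of_bool (T (s + 1))) (nat (int p * int (x s) - c s A))" by blast
  \<comment> \<open>The signed numbers \<open>p x_s - x_(s+1)\<close> are split: positive parts are
    the types taken from \<open>A\<close>, negative parts those taken from \<open>V\<close>. Then
    \<open>l s Y - l s X = Q x_s\<close>.\<close>
  have "\<exists>Y. Y \<subseteq># A \<and> (\<forall>s. c s Y = max 0 (int p * int (x s) - int (x (s + 1))))"
  proof (rule select_types)
    fix s
    show "max 0 (int p * int (x (s + int f)) - int (x (s + int f + 1))) = max 0 (int p * int (x s) - int (x (s + 1)))"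
      using xper[of "s + 1"] by (simp add: xper algebra_simps)
    show "max 0 (int p * int (x s) - int (x (s + 1))) \<le> c s A" using xs[of s] cnt_nonneg[of p f s A] by linarith
  qed simp
  then obtain Y where Y: "Y \<subseteq># A" "\<And>s. c s Y = max 0 (int p * int (x s) - int (x (s + 1)))" by blast
  have "\<exists>X. X \<subseteq># filter_mset lo V \<and> (\<forall>s. c s X = max 0 (int (x (s + 1)) - int p * int (x s)))"
  proof (rule select_types)
    fix s
    show "max 0 (int (x (s + int f + 1)) - int p * int (x (s + int f))) = max 0 (int (x (s + 1)) - int p * int (x s))"
      using xper[of "s + 1"] by (simp add: xper algebra_simps)
    show "max 0 (int (x (s + 1)) - int p * int (x s)) \<le> c s (filter_mset lo V)"
    proof (cases "int (x (s + 1)) > int p * int (x s)")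
      case True
      have "int p * int (x s) \<ge> 0" by simp
      then have "x (s + 1) = of_bool (T (s + 1))" 
        using True xs[of s] cnt_nonneg[of p f s A] by linarith
      moreover have "x (s + 1) > 0" using True \<open>int p * int (x s) \<ge> 0\<close> by linarith
      ultimately have T: "T (s + 1)" and x1: "x (s + 1) = 1" by (auto simp: of_bool_def split: if_splits)
      have x0: "x s = 0" 
      proof (rule ccontr)
        assume "x s \<noteq> 0"
        then have "int p * 1 \<le> int p * int (x s)" by (intro mult_left_mono) auto
        then show False using True x1 p_ge by linarith
      qed
      \<comment> \<open>A negative part forces \<open>x_s = 0\<close> and
        \<open>x_(s+1) = 1\<close>, so \<open>T\<close> begins at \<open>s + 1\<close>; this
        excludes the second alternative of \<open>H\<close> and leaves a low element of the required
        type.\<close>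
      have "\<not> T s" using xb[of s] x0 by auto
      then obtain u where u: "u \<in># V" "lo u" "w (s + 1) u = 1"
        using H[of "s + 1"] T unfolding T_def by auto
      then have "{#u#} \<subseteq># filter_mset lo V" by simp
      from cnt_mono[OF this, of p f s] show ?thesis using u x1 x0 by simp
    qed (use cnt_nonneg[of p f s "filter_mset lo V"] in auto)
  qed simp
  then obtain X where X: "X \<subseteq># filter_mset lo V" "\<And>s. c s X = max 0 (int (x (s + 1)) - int p * int (x s))" by blast
  have "l s Y - l s X - Q * int (x s) = 0" for s
  proof (rule geometric_periodic_zero[where E = "\<lambda>s. l s Y - l s X - Q * int (x s)"])
    fix s
    show "l (s + int f) Y - l (s + int f) X - Q * int (x (s + int f)) = l s Y - l s X - Q * int (x s)"
      by (simp add: xper)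
    have "c s Y - c s X = int p * int (x s) - int (x (s + 1))" using X(2)[of s] Y(2)[of s] by linarith
    moreover have "l (s + 1) Y - l (s + 1) X = int p * (l s Y - l s X) - Q * (c s Y - c s X)"
      unfolding l_step by (simp add: algebra_simps)
    ultimately have "l (s + 1) Y - l (s + 1) X = int p * (l s Y - l s X) - Q * (int p * int (x s) - int (x (s + 1)))"
      by (simp only:)
    then show "l (s + 1) Y - l (s + 1) X - Q * int (x (s + 1)) = int p * (l s Y - l s X - Q * int (x s))"
      by (simp add: right_diff_distrib)
  qed
  then have YX: "l s Y = l s X + Q * int (x s)" for s by (simp add: algebra_simps)
  have xle: "Q * int (x s) \<le> l s A - \<phi> s" for s
  proof -
    have "int (x s) * Q \<le> int (y s) * Q" using xy[of s] Q_pos by (intro mult_right_mono) auto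
    then show ?thesis using Qy[of s] by (simp add: mult.commute)
  qed
  have x0: "0 \<le> Q * int (x s)" for s using Q_pos by simp
  show ?thesis
  proof (rule exI[of _ X], rule exI[of _ Y], intro conjI allI impI)
    fix s
    have "l s A - l s Y + l s X - \<phi> s = (l s A - \<phi> s) - Q * int (x s)" by (simp add: YX)
    then show "Q dvd l s A - l s Y + l s X - \<phi> s" using A(1)[of s] by (simp only: dvd_diff dvd_triv_left)
    show "\<phi> s \<le> l s A - l s Y + l s X" using xle[of s] by (simp add: YX)
    show "Q dvd l s V - l s X + l s Y" using V(1)[of s] by (simp add: YX)
    show "Q \<le> l s V - l s X + l s Y" using V(2)[of s] x0[of s] by (simp add: YX)
    assume a: "Bad s \<and> (2 * Q \<le> l s V \<or> \<phi> s + Q \<le> l s A)"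
    show "2 * Q \<le> l s V - l s X + l s Y"
    proof (cases "2 * Q \<le> l s V")
      case True then show ?thesis using x0[of s] by (simp add: YX)
    next
      case False
      have "Q dvd l s V - Q" using V(1)[of s] by simp
      from dvd_gap[OF this] have "l s V = Q" using V(2)[of s] False by linarith
      then have "T s" using a False by (simp add: T_def)
      then have "1 \<le> x s" using xb[of s] by simp
      then have "Q * 1 \<le> Q * int (x s)" using Q_pos by (intro mult_left_mono) auto
      then show ?thesis using V(2)[of s] by (simp add: YX)
    qed
  qed (use X Y in auto)
qed

section \<open>Chains of digit multisets\<close>

text \<open>Indices ascend: \<open>G D\<close> stands for \<open>h_1\<close> and \<open>G 0\<close>
  for the last of \<open>D + 1\<close> members, which may be empty. \<open>G D = K\<close> is
  allowed, and is excluded only later, for optimal chains, in \<open>optimal_proper\<close>.\<close>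

definition chain :: "nat multiset \<Rightarrow> nat \<Rightarrow> (nat \<Rightarrow> nat multiset) \<Rightarrow> bool" where
  "chain K D G \<longleftrightarrow> (\<forall>i<D. G i \<subset># G (Suc i)) \<and> G D \<subseteq># K \<and> (\<forall>i\<le>D. \<forall>s. Q dvd l s (G i) - l s K)"

definition cost :: "(nat \<Rightarrow> nat) \<Rightarrow> nat \<Rightarrow> (nat \<Rightarrow> nat multiset) \<Rightarrow> nat" where
  "cost v D G = (\<Sum>i\<le>D. v i * N (G i))"

abbreviation "th K s \<equiv> l s K mod Q"

lemma chain_mono:
  assumes "chain K D G" "i \<le> j" "j \<le> D" shows "G i \<subseteq># G j"
  using assms(2,3)
proof (induction j rule: dec_induct)
  case (step n)
  then show ?case using assms(1) unfolding chain_def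
    by (meson Suc_le_lessD less_imp_le subset_mset.less_imp_le subset_mset.order_trans)
qed simp

lemma chain_dvd:
  assumes "chain K D G" "i \<le> D" shows "Q dvd l s (G i) - (th K s + j * Q)"
proof -
  have "Q dvd l s (G i) - l s K" using assms by (auto simp: chain_def)
  moreover have "Q dvd l s K - th K s" by (simp add: minus_mod_eq_mult_div)
  ultimately have "Q dvd (l s (G i) - l s K) + (l s K - th K s)" by (rule dvd_add)
  then have "Q dvd ((l s (G i) - l s K) + (l s K - th K s)) - j * Q" by (rule dvd_diff) simp
  then show ?thesis by (simp add: algebra_simps)
qed

lemma chain_diff:
  assumes "chain K D G" "i < D" 
  shows "Q dvd l s (G (Suc i) - G i)" "Q \<le> l s (G (Suc i) - G i)"
proof -
  have sub: "G i \<subset># G (Suc i)" using assms by (auto simp: chain_def)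
  have "Q dvd l s (G (Suc i)) - l s K" "Q dvd l s (G i) - l s K"
    using assms by (auto simp: chain_def)
  then have "Q dvd (l s (G (Suc i)) - l s K) - (l s (G i) - l s K)" by (rule dvd_diff)
  then show *: "Q dvd l s (G (Suc i) - G i)" using sub by (simp add: subset_mset.less_imp_le)
  have "G (Suc i) - G i \<noteq> {#}" using sub by (simp add: Diff_eq_empty_iff_mset subset_mset.less_le_not_le)
  from l_pos[OF this, of s] show "Q \<le> l s (G (Suc i) - G i)" using * by (simp add: zdvd_imp_le)
qed

lemma chain_lower:
  assumes "chain K D G" "i \<le> D" shows "th K s + int i * Q \<le> l s (G i)"
  using assms(2)
proof (induction i)
  case 0
  have "l s (G 0) mod Q = th K s" using assms(1) by (auto simp: chain_def mod_eq_dvd_iff)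
  moreover have "l s (G 0) mod Q \<le> l s (G 0)" using l_nonneg Q_pos by (simp add: zmod_le_nonneg_dividend)
  ultimately show ?case by simp
next
  case (Suc i)
  have "G i \<subseteq># G (Suc i)" using chain_mono[OF assms(1), of i "Suc i"] Suc.prems by simp
  then show ?case using Suc chain_diff(2)[OF assms(1), of i s] by (simp add: algebra_simps)
qed

lemma chain_ext:
  assumes "B \<subseteq># K" "\<And>s. th K s + int D * Q \<le> l s B"
  shows "\<exists>G. chain K D G \<and> G D \<subseteq># B"
  using assms
proof (induction D arbitrary: B)
  case 0
  obtain M where M: "M \<subseteq># B" "\<And>s. Q dvd l s M - th K s" 
    using ex_residual_sub[OF residual_mod[of K], of 0 B] 0 by auto
  have "Q dvd l s M - l s K" for s
  proof -
    have "Q dvd (l s M - th K s) - (l s K - th K s)" 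
      by (rule dvd_diff[OF M(2)]) (simp add: minus_mod_eq_mult_div)
    then show ?thesis by simp
  qed
  then show ?case using M(1) 0 by (intro exI[of _ "\<lambda>_. M"]) (auto simp: chain_def intro: subset_mset.order_trans)
next
  case (Suc D)
  obtain M where M: "M \<subseteq># B" "\<And>s. Q dvd l s M - th K s" "\<And>s. th K s + int (Suc D) * Q \<le> l s M"
    using ex_residual_sub[OF residual_mod[of K], of "Suc D" B] Suc.prems by blast
  have "0 \<le> th K 0" using Q_pos by simp
  moreover have "0 \<le> int D * Q" using Q_pos by simp
  ultimately have "l 0 M > 0" using M(3)[of 0] Q_pos unfolding of_nat_Suc distrib_right by linarith
  then obtain x where x: "x \<in># M" by (metis lv_simps(1) less_irrefl multiset_nonemptyE)
  have "th K s + int D * Q \<le> l s (M - {#x#})" for s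
    using M(3)[of s] w_le[of s x] x by (simp add: algebra_simps)
  moreover have "M - {#x#} \<subseteq># K" by (meson M(1) Suc.prems(1) diff_subset_eq_self subset_mset.order_trans)
  ultimately obtain G where G: "chain K D G" "G D \<subseteq># M - {#x#}" using Suc.IH by blast
  have "G D \<subset># M" using G(2) x by (meson mset_subset_diff_self subset_mset.le_less_trans)
  moreover have "Q dvd l s M - l s K" for s
  proof -
    have "Q dvd (l s M - th K s) - (l s K - th K s)" 
      by (rule dvd_diff[OF M(2)]) (simp add: minus_mod_eq_mult_div)
    then show ?thesis by simp
  qed
  moreover have "M \<subseteq># K" using M(1) Suc.prems(1) by (rule subset_mset.order_trans)
  ultimately have "chain K (Suc D) (G(Suc D := M))" using G(1)
    by (auto simp: chain_def less_Suc_eq le_Suc_eq)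
  moreover have "(G(Suc D := M)) (Suc D) \<subseteq># B" using M(1) by simp
  ultimately show ?case by blast
qed

section \<open>Comparison of weights under rotation of the index\<close>

definition rk :: "int \<Rightarrow> nat \<Rightarrow> nat" where "rk s x = nat ((int x + s) mod int f)"

lemma w_rk: "w s x = int p ^ rk s x" by (simp add: wt_def rk_def)
lemma rk_less: "rk s x < f" using f0 by (simp add: rk_def nat_less_iff)

lemma rk_shift_less: 
  assumes "rk s x + j < f" shows "w (s + int j) x = int p ^ j * w s x"
proof -
  have "(int x + (s + int j)) mod int f = ((int x + s) mod int f + int j) mod int f"
    by (simp add: mod_simps add.assoc)
  also have "\<dots> = (int x + s) mod int f + int j"
    using assms f0 unfolding rk_def by (intro mod_pos_pos_trivial) auto
  finally have "rk (s + int j) x = rk s x + j" unfolding rk_def using f0 by (simp add: nat_add_distrib)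
  then show ?thesis by (simp add: w_rk power_add)
qed

lemma rk_shift_ge: 
  assumes "f \<le> rk s x + j" "j \<le> f" shows "rk (s + int j) x + f = rk s x + j"
proof -
  have "(int x + (s + int j)) mod int f = ((int x + s) mod int f + int j - int f) mod int f"
    by (simp add: mod_simps add.assoc)
  also have "\<dots> = (int x + s) mod int f + int j - int f"
  proof (rule mod_pos_pos_trivial)
    have "int (rk s x) = (int x + s) mod int f" using f0 by (simp add: rk_def)
    then show "0 \<le> (int x + s) mod int f + int j - int f" "(int x + s) mod int f + int j - int f < int f"
      using assms rk_less[of s x] by linarith+
  qed
  finally have "rk (s + int j) x = nat (int (rk s x) + int j - int f)" unfolding rk_def using f0 by simp
  then show ?thesis using assms by linarith
qed

lemma w_shift_ge:
  assumes "f \<le> rk s x + j" "j \<le> f" shows "int p ^ f * w (s + int j) x = int p ^ j * w s x"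
  using rk_shift_ge[OF assms] by (simp add: w_rk power_add[symmetric] add.commute)

lemma l_shift_less:
  assumes "\<And>x. x \<in># M \<Longrightarrow> rk s x + j < f" shows "l (s + int j) M = int p ^ j * l s M"
  using assms by (induction M) (auto simp: rk_shift_less distrib_left)

lemma l_shift_ge:
  assumes "\<And>x. x \<in># M \<Longrightarrow> f \<le> rk s x + j" "j \<le> f" shows "int p ^ f * l (s + int j) M = int p ^ j * l s M"
  using assms by (induction M) (auto simp: w_shift_ge distrib_left)

lemma l_shift_le: "l (s + int j) M \<le> int p ^ j * l s M"
proof (induction j)
  case (Suc j)
  have "0 \<le> Q * c (s + int j) M" using Q_pos cnt_nonneg by simp
  then have "l (s + int j + 1) M \<le> int p * l (s + int j) M" unfolding l_step by simp
  also have "\<dots> \<le> int p * (int p ^ j * l s M)" using Suc by (intro mult_left_mono) auto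
  finally show ?case by (simp add: algebra_simps)
qed simp

lemma w_mod: "s mod int f = s' mod int f \<Longrightarrow> w s x = w s' x"
  using periodic_mod[of "\<lambda>s. w s x" s s'] by simp

lemma l_mod: "s mod int f = s' mod int f \<Longrightarrow> l s M = l s' M"
  using periodic_mod[of "\<lambda>s. l s M" s s'] by simp

lemma rk_lt: 
  assumes "w s x < w s y" shows "rk s x < rk s y"
  using assms p_ge unfolding w_rk by (metis linorder_not_le power_increasing dual_order.trans one_le_numeral)

lemma rk_lt_mem: "x \<in># M \<Longrightarrow> l s M < w s y \<Longrightarrow> rk s x < rk s y"
  using l_mem[of x M s] by (intro rk_lt) linarith

text \<open>Advance from \<open>\<sigma>\<close> until \<open>x\<close> wraps to weight 1. As
  \<open>e\<close> and the elements of \<open>z\<close> are lighter than \<open>x\<close> at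
  \<open>\<sigma>\<close>, none of them has wrapped by then, so the inequality between
  \<open>e\<close> and \<open>z\<close> has only been scaled by a power of \<open>p\<close>.\<close>

lemma not_bad:
  assumes \<sigma>: "w \<sigma> e \<le> l \<sigma> z" "l \<sigma> z < w \<sigma> x" and s: "w s x = 1"
  shows "w s e \<le> l s z"
proof -
  define j where "j = f - rk \<sigma> x"
  have j: "rk \<sigma> x + j = f" using rk_less[of \<sigma> x] by (simp add: j_def)
  have "rk (\<sigma> + int j) x = 0" using rk_shift_ge[of \<sigma> x j] j by simp
  then have "(int x + (\<sigma> + int j)) mod int f = 0" unfolding rk_def using f0 by (simp add: order_antisym)
  moreover have "(int x + s) mod int f = 0" using s by (simp add: w_eq_1)
  ultimately have "int f dvd (int x + (\<sigma> + int j)) - (int x + s)" by (intro dvd_diff) auto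
  then have eq: "(\<sigma> + int j) mod int f = s mod int f" by (simp add: mod_eq_dvd_iff)
  have "rk \<sigma> e < rk \<sigma> x" using \<sigma> by (intro rk_lt) linarith
  then have we: "w (\<sigma> + int j) e = int p ^ j * w \<sigma> e" using j by (intro rk_shift_less) simp
  have "l (\<sigma> + int j) z = int p ^ j * l \<sigma> z" using rk_lt_mem[OF _ \<sigma>(2)] j by (intro l_shift_less) force
  then have "w (\<sigma> + int j) e \<le> l (\<sigma> + int j) z" using we \<sigma>(1) by (simp add: mult_left_mono)
  then show ?thesis using w_mod[OF eq] l_mod[OF eq] by simp
qed

text \<open>While \<open>e\<close> does not wrap, its weight grows by exactly \<open>p\<close> per
  step and that of a multiset by at most \<open>p\<close>, so a multiset lighter than
  \<open>e\<close> stays lighter. Hence the index at which \<open>e\<close> has the larger exponent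
  inherits the inequality from the other one.\<close>

lemma bad_nested:
  assumes "l s1 A < w s1 e" "l s2 B < w s2 e"
  shows "l s1 B < w s1 e \<or> l s2 A < w s2 e"
proof -
  have *: "l s2 A < w s2 e" if "l s1 A < w s1 e" "rk s1 e \<le> rk s2 e" for s1 s2 A
  proof -
    define j where "j = rk s2 e - rk s1 e"
    have j: "rk s1 e + j = rk s2 e" using that by (simp add: j_def)
    have "int (rk s2 e) = (int e + s2) mod int f" "int (rk s1 e) = (int e + s1) mod int f"
      using f0 by (auto simp: rk_def)
    then have "(int e + s2) mod int f = ((int e + s1) mod int f + int j) mod int f"
      using j by (metis mod_mod_trivial of_nat_add)
    then have "int f dvd (int e + s2) - (int e + s1 + int j)" by (simp add: mod_simps mod_eq_dvd_iff)
    then have eq: "s2 mod int f = (s1 + int j) mod int f" by (simp add: mod_eq_dvd_iff algebra_simps)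
    have "l (s1 + int j) A \<le> int p ^ j * l s1 A" by (rule l_shift_le)
    also have "\<dots> < int p ^ j * w s1 e" using that p2 by (intro mult_strict_left_mono) auto
    also have "\<dots> = w (s1 + int j) e" using j rk_less[of s2 e] by (intro rk_shift_less[symmetric]) simp
    finally show ?thesis using w_mod[OF eq] l_mod[OF eq] by simp
  qed
  show ?thesis using *[of s1 A s2] *[of s2 B s1] assms by linarith
qed

text \<open>Take \<open>x\<close> of largest exponent in \<open>h\<close> at \<open>s\<close>, and
  advance to its \<open>\<sigma>\<close>. The inequality between \<open>z\<close> and
  \<open>e\<close> is reversed on the way, which forces \<open>e\<close> to wrap. If
  \<open>x\<close> wrapped too, so would every element of \<open>z\<close>, and the inequality would
  be scaled without reversal. So nothing in \<open>h\<close> wraps, and its weight, above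
  \<open>Q\<close> at \<open>s\<close>, has grown at least by the factor \<open>p\<close>, against
  \<open>l \<sigma> h \<le> Q\<close>.\<close>

lemma high_part_contradiction:
  assumes s: "l s z < w s e" and h: "Q < l s h"
    and ex: "\<And>x. x \<in># h \<Longrightarrow> \<exists>\<sigma>. w \<sigma> e \<le> l \<sigma> z \<and> l \<sigma> z < w \<sigma> x \<and> l \<sigma> h \<le> Q"
  shows False
proof -
  have "h \<noteq> {#}" using h Q_pos by auto
  then have "rk s ` set_mset h \<noteq> {}" by simp
  then have "Max (rk s ` set_mset h) \<in> rk s ` set_mset h" by (intro Max_in) auto
  then obtain x where x: "x \<in># h" "rk s x = Max (rk s ` set_mset h)" by auto
  have max: "rk s u \<le> rk s x" if "u \<in># h" for u unfolding x(2) using that by (intro Max_ge) auto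
  obtain \<sigma>' where \<sigma>': "w \<sigma>' e \<le> l \<sigma>' z" "l \<sigma>' z < w \<sigma>' x" "l \<sigma>' h \<le> Q" using ex[OF x(1)] by blast
  define j where "j = nat ((\<sigma>' - s) mod int f)"
  have jf: "j < f" using f0 by (simp add: j_def nat_less_iff)
  have "int j = (\<sigma>' - s) mod int f" using f0 by (simp add: j_def)
  then have "(s + int j) mod int f = \<sigma>' mod int f" by (simp add: mod_simps)
  note eq = w_mod[OF this] l_mod[OF this]
  have \<sigma>: "w (s + int j) e \<le> l (s + int j) z" "l (s + int j) z < w (s + int j) x" "l (s + int j) h \<le> Q"
    using \<sigma>' unfolding eq .
  have less: "int p ^ j * l s z < int p ^ j * w s e" using s p2 by (intro mult_strict_left_mono) auto
  have z: "rk s y < rk s e" if "y \<in># z" for y using rk_lt_mem[OF that s] .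
  have 1: "f \<le> rk s e + j"
  proof (rule ccontr)
    assume a: "\<not> ?thesis"
    then have "w (s + int j) e = int p ^ j * w s e" by (intro rk_shift_less) simp
    moreover have "l (s + int j) z = int p ^ j * l s z" using a z by (intro l_shift_less) force
    ultimately show False using less \<sigma>(1) by simp
  qed
  have 2: "rk s x + j < f"
  proof (rule ccontr)
    assume a: "\<not> ?thesis"
    then have rx: "rk (s + int j) x + f = rk s x + j" using jf by (intro rk_shift_ge) auto
    have "f \<le> rk s y + j" if y: "y \<in># z" for y
    proof (rule ccontr)
      assume b: "\<not> ?thesis"
      then have "w (s + int j) y = int p ^ j * w s y" by (intro rk_shift_less) simp
      then have "int p ^ j \<le> w (s + int j) y" using w_pos[of s y] mult_left_mono[of 1 "w s y" "int p ^ j"] by simp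
      moreover have "w (s + int j) y < w (s + int j) x" using l_mem[OF y] \<sigma>(2) by (rule order_le_less_trans)
      moreover have "w (s + int j) x \<le> int p ^ j" 
        unfolding w_rk using rx rk_less[of s x] p2 by (intro power_increasing) auto
      ultimately show False by simp
    qed
    then have "int p ^ f * l (s + int j) z = int p ^ j * l s z" using jf by (intro l_shift_ge) auto
    moreover have "int p ^ f * w (s + int j) e = int p ^ j * w s e" using 1 jf by (intro w_shift_ge) auto
    ultimately have "int p ^ f * l (s + int j) z < int p ^ f * w (s + int j) e" using less by simp
    then show False using \<sigma>(1) by (simp add: mult_less_cancel_left)
  qed
  have "l (s + int j) h = int p ^ j * l s h" using max 2 by (intro l_shift_less) force
  moreover have "int p ^ 1 \<le> int p ^ j" using 1 rk_less[of s e] p2 by (intro power_increasing) auto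
  ultimately have "int p * l s h \<le> l (s + int j) h" using l_nonneg[of s h] by (simp add: mult_right_mono)
  moreover have "2 * l s h \<le> int p * l s h" using l_nonneg[of s h] p_ge by (intro mult_right_mono) auto
  ultimately show False using \<sigma>(3) h Q_pos by linarith
qed

section \<open>An exchange argument\<close>

definition low :: "nat \<Rightarrow> nat multiset \<Rightarrow> nat multiset" where
  "low e M = {#x \<in># M. x < e#}"

lemma low_sub: "low e M \<subseteq># M" by (simp add: low_def)

lemma low_add: "low e (A + B) = low e A + low e B" by (simp add: low_def)

lemma low_telescope:
  assumes "\<And>i. i < n \<Longrightarrow> G i \<subseteq># G (Suc i)"
  shows "(\<Sum>i<n. N (low e (G (Suc i) - G i))) + N (low e (G 0)) = N (low e (G n))"
  using assms
proof (induction n)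
  case (Suc n)
  have "G (Suc n) = G n + (G (Suc n) - G n)" using Suc.prems[of n] by (simp add: subset_mset.add_diff_inverse)
  then have "N (low e (G (Suc n))) = N (low e (G n)) + N (low e (G (Suc n) - G n))"
    by (metis low_add val_simps(3))
  then show ?case using Suc by simp
qed simp

lemma val_low_less:
  assumes "\<And>x. count K x < p" "A \<subseteq># low e K"
  shows "N A < p ^ e"
proof (rule val_low)
  fix x
  have "count A x \<le> count K x" using assms(2) low_sub by (meson mset_subset_eq_count subset_mset.order_trans)
  then show "count A x < p" using assms(1)[of x] by simp
  show "x < e" if "x \<in># A" using mset_subset_eqD[OF assms(2) that] by (simp add: low_def)
qed

text \<open>
  Only the first member of a chain may have a nonzero residue; all later differences are nonempty with
  value divisible by \<open>q - 1\<close>. In \<open>shifted\<close>, \<open>P (Suc i)\<close> replaces \<open>G i\<close>, and \<open>A\<close> is the part of \<open>G n\<close> not yet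
  used; it inherits the surplus of all earlier differences at the indices where \<open>z\<close> cannot make up for
  the loss of \<open>e\<close>.
\<close>

definition floor_of :: "nat multiset \<Rightarrow> nat \<Rightarrow> int \<Rightarrow> int" where
  "floor_of K n s = (if n = 0 then th K s else Q)"

definition shifted :: "nat multiset \<Rightarrow> (nat \<Rightarrow> nat multiset) \<Rightarrow> nat \<Rightarrow> nat multiset \<Rightarrow> nat \<Rightarrow> (nat \<Rightarrow> nat multiset) \<Rightarrow> nat multiset \<Rightarrow> bool" where
  "shifted K G e z n P A \<longleftrightarrow> P 0 = {#} \<and> P n + A = G n \<and> (\<forall>i. 0 < i \<and> i < n \<longrightarrow> P i \<subset># P (Suc i)) \<and>
     (\<forall>i<n. \<forall>s. Q dvd l s (P (Suc i)) - l s K) \<and>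
     (\<forall>i<n. N (P (Suc i)) \<le> N (G i) + N (low e (G (Suc i) - G i))) \<and>
     (\<forall>s. Q dvd l s A - floor_of K n s \<and> floor_of K n s \<le> l s A) \<and>
     (\<forall>s. l s z < w s e \<and> th K s + (int n + 1) * Q \<le> l s (G n) \<longrightarrow> floor_of K n s + Q \<le> l s A) \<and>
     (0 < n \<and> e \<in># G n - G (n - 1) \<longrightarrow> e \<in># A)"

lemma shift_chain:
  assumes K: "\<And>x. count K x < p" and ch: "chain K D G" and n: "n \<le> D" and D0: "0 < D"
    and e: "e \<in># G D - G (D - 1)"
    and z: "z \<subseteq># low e (K - G D)"
    and B: "\<And>s. th K s + int D * Q \<le> l s (G D) - w s e + l s z"
    and C: "\<And>x s. x \<in># G D \<Longrightarrow> e < x \<Longrightarrow> w s x = 1 \<Longrightarrow> w s e \<le> l s z"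
  shows "\<exists>P A. shifted K G e z n P A"
  using n
proof (induction n)
  case 0
  have "Q dvd l s (G 0) - th K s" for s using chain_dvd[OF ch, of 0 s 0] by simp
  moreover have "th K s \<le> l s (G 0)" for s using chain_lower[OF ch, of 0 s] by simp
  ultimately show ?case by (intro exI[of _ "\<lambda>_. {#}"] exI[of _ "G 0"]) (simp add: shifted_def floor_of_def)
next
  case (Suc n)
  then have "n \<le> D" by simp
  from Suc.IH[OF this] obtain P A where "shifted K G e z n P A" by blast
  note inv = this[unfolded shifted_def]
  have P0: "P 0 = {#}" and PA: "P n + A = G n" using inv by blast+
  have Pch: "\<And>i. 0 < i \<Longrightarrow> i < n \<Longrightarrow> P i \<subset># P (Suc i)" using inv by blast
  have Pdvd: "\<And>i s. i < n \<Longrightarrow> Q dvd l s (P (Suc i)) - l s K" using inv by blast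
  have PN: "\<And>i. i < n \<Longrightarrow> N (P (Suc i)) \<le> N (G i) + N (low e (G (Suc i) - G i))" using inv by blast
  have A: "\<And>s. Q dvd l s A - floor_of K n s" "\<And>s. floor_of K n s \<le> l s A" using inv by blast+
  have AB: "\<And>s. l s z < w s e \<Longrightarrow> th K s + (int n + 1) * Q \<le> l s (G n) \<Longrightarrow> floor_of K n s + Q \<le> l s A" using inv by blast
  have nD: "n < D" using Suc.prems by simp
  define V where "V = G (Suc n) - G n"
  have GG: "G n \<subseteq># G (Suc n)" using chain_mono[OF ch, of n "Suc n"] Suc.prems by simp
  then have GV: "G (Suc n) = G n + V" by (simp add: V_def subset_mset.add_diff_inverse)
  have Vd: "Q dvd l s V" "Q \<le> l s V" for s using chain_diff[OF ch nD] by (auto simp: V_def)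
  have VGD: "V \<subseteq># G D" using chain_mono[OF ch Suc.prems] V_def by (meson diff_subset_eq_self le_refl subset_mset.order_trans)
  have \<phi>res: "residual (floor_of K n)" using residual_mod[of K] residual_const by (cases n) (simp_all add: floor_of_def[abs_def])
  have GDK: "G D \<subseteq># K" using ch by (simp add: chain_def)
  have H: "(\<exists>x\<in>#V. x < e \<and> w s x = 1) \<or> (l (s - 1) z < w (s - 1) e \<and> l (s - 1) V = Q \<and> floor_of K n (s - 1) + Q \<le> l (s - 1) A)"
    if bad: "l s z < w s e" and lV: "l s V = Q" for s
  proof (rule disjCI)
    assume a: "\<not> (l (s - 1) z < w (s - 1) e \<and> l (s - 1) V = Q \<and> floor_of K n (s - 1) + Q \<le> l (s - 1) A)"
    let ?F = "{#x \<in># V. w s x = 1#}"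
    have cF: "c (s - 1) V = int (size ?F)" by (simp add: cnt_def)
    have step: "Q = int p * l (s - 1) V - Q * c (s - 1) V" using l_step[of "s - 1" V] lV by simp
    show "\<exists>x\<in>#V. x < e \<and> w s x = 1"
    proof (rule ccontr)
      assume nex: "\<not> ?thesis"
      \<comment> \<open>With no low element of weight 1, and those above \<open>e\<close> excluded
        by \<open>C\<close>, only copies of \<open>e\<close> itself remain.\<close>
      have eq: "x = e" if "x \<in># ?F" for x
      proof (rule ccontr)
        assume "x \<noteq> e"
        then have "e < x" "x \<in># V" "w s x = 1" using nex that by force+
        then show False using C[of x s] bad mset_subset_eqD[OF VGD] by force
      qed
      have "size ?F \<le> count V e"
      proof -
        have "?F = replicate_mset (size ?F) e" by (rule set_mset_subset_singletonD) (use eq in blast)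
        then have "size ?F = count ?F e" by (metis count_replicate_mset)
        then show ?thesis by simp
      qed
      \<comment> \<open>Since \<open>l (s - 1) V\<close> is at least \<open>Q\<close>, coming down
        to \<open>l s V = Q\<close> takes at least \<open>p - 1\<close> wraps, hence at least
        \<open>p - 1\<close> copies of \<open>e\<close> in \<open>V\<close>.\<close>
      have "int p * Q \<le> int p * l (s - 1) V" using Vd(2)[of "s - 1"] by (intro mult_left_mono) auto
      then have "Q * (int p - 1) \<le> Q * c (s - 1) V" using step by (simp add: algebra_simps)
      then have c1: "int p - 1 \<le> c (s - 1) V" using Q_pos by (simp add: mult_le_cancel_left)
      then have "0 < size ?F" using cF p_ge by linarith
      then have "?F \<noteq> {#}" by (simp only: nonempty_has_size)
      then obtain x where "x \<in># ?F" by (meson multiset_nonemptyE)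
      then have "w s e = 1" using eq by force
      then have "l s z = 0" using bad l_nonneg[of s z] by simp
      then have z0: "z = {#}" using l_pos[of z s] by force
      have badall: "l u z < w u e" for u using z0 w_pos[of u e] by simp
      have Ke: "count K e < p" by (rule K)
      have GKe: "count (G D) e \<le> count K e" using GDK by (rule mset_subset_eq_count)
      show False
      proof (cases "Suc n < D")
        \<comment> \<open>Before the last difference, \<open>V\<close> lies in
          \<open>G (D - 1)\<close>, which has fewer copies of \<open>e\<close> than
          \<open>G D\<close>; so \<open>V\<close> has at most \<open>p - 2\<close> of them.\<close>
        case True
        then have "G (Suc n) \<subseteq># G (D - 1)" by (intro chain_mono[OF ch]) auto
        moreover have "V \<subseteq># G (Suc n)" by (simp add: V_def)
        ultimately have "V \<subseteq># G (D - 1)" by (meson subset_mset.order_trans)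
        then have "count V e \<le> count (G (D - 1)) e" by (rule mset_subset_eq_count)
        moreover have "count (G (D - 1)) e < count (G D) e" using e by (simp add: in_diff_count)
        ultimately show False using \<open>size ?F \<le> count V e\<close> c1 cF Ke GKe by linarith
      next
        case False
        then have nD': "D = Suc n" using Suc.prems by simp
        have lV': "l (s - 1) V = Q"
        proof (rule ccontr)
          assume "\<not> ?thesis"
          then have "Q < l (s - 1) V" using Vd(2)[of "s - 1"] by simp
          moreover have "Q dvd l (s - 1) V - Q" using Vd(1) by simp
          ultimately have "Q + Q \<le> l (s - 1) V" using dvd_gap by blast
          then have "int p * (Q + Q) \<le> int p * l (s - 1) V" by (intro mult_left_mono) auto
          then have "Q * (2 * int p - 1) \<le> Q * c (s - 1) V" using step by (simp add: algebra_simps)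
          then have "2 * int p - 1 \<le> c (s - 1) V" using Q_pos by (simp add: mult_le_cancel_left)
          moreover have "count V e \<le> count (G D) e" using VGD by (rule mset_subset_eq_count)
          ultimately show False using \<open>size ?F \<le> count V e\<close> cF Ke GKe by linarith
        qed
        \<comment> \<open>In the last difference there is no such gap. But \<open>z\<close> is
          empty, so every index is bad; \<open>B\<close> then gives \<open>G D\<close> a surplus at
          \<open>s - 1\<close>, and \<open>AB\<close> passes it to \<open>A\<close>, which is the
          second alternative.\<close>
        have "th K (s - 1) + int D * Q < l (s - 1) (G D)" using B[of "s - 1"] badall[of "s - 1"] by linarith
        from dvd_gap[OF chain_dvd[OF ch order_refl] this] 
        have "th K (s - 1) + int D * Q + Q \<le> l (s - 1) (G D)" .
        then have "th K (s - 1) + (int n + 1) * Q \<le> l (s - 1) (G n)"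
          using lV' unfolding nD' GV by (simp add: algebra_simps)
        from AB[OF badall this] show False using a badall lV' by blast
      qed
    qed
  qed
  have "\<exists>X Y. X \<subseteq># filter_mset (\<lambda>x. x < e) V \<and> Y \<subseteq># A \<and> 
     (\<forall>s. Q dvd l s A - l s Y + l s X - floor_of K n s \<and> floor_of K n s \<le> l s A - l s Y + l s X) \<and>
     (\<forall>s. Q dvd l s V - l s X + l s Y \<and> Q \<le> l s V - l s X + l s Y) \<and>
     (\<forall>s. l s z < w s e \<and> (2 * Q \<le> l s V \<or> floor_of K n s + Q \<le> l s A) \<longrightarrow> 2 * Q \<le> l s V - l s X + l s Y)"
  proof (rule shift_step[where Bad = "\<lambda>s. l s z < w s e", OF \<phi>res A Vd])
    show "(l (s + int f) z < w (s + int f) e) = (l s z < w s e)" for s by simp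
  qed (use H in blast)
  then obtain X Y where X: "X \<subseteq># low e V" and Y: "Y \<subseteq># A"
    and AX: "\<And>s. Q dvd l s A - l s Y + l s X - floor_of K n s" "\<And>s. floor_of K n s \<le> l s A - l s Y + l s X"
    and VX: "\<And>s. Q dvd l s V - l s X + l s Y" "\<And>s. Q \<le> l s V - l s X + l s Y"
    and VB: "\<And>s. l s z < w s e \<Longrightarrow> 2 * Q \<le> l s V \<or> floor_of K n s + Q \<le> l s A \<Longrightarrow> 2 * Q \<le> l s V - l s X + l s Y"
    unfolding low_def by blast
  have XV: "X \<subseteq># V" using X low_sub by (rule subset_mset.order_trans)
  define M where "M = A - Y + X"
  define A' where "A' = V - X + Y"
  define P' where "P' = P(Suc n := P n + M)"
  have lM: "l s M = l s A - l s Y + l s X" for s unfolding M_def by (simp only: lv_simps lv_diff[OF Y])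
  have lA': "l s A' = l s V - l s X + l s Y" for s unfolding A'_def by (simp only: lv_simps lv_diff[OF XV])
  have "M + A' = A + V" unfolding M_def A'_def using XV Y
    by (metis add.assoc add.commute subset_mset.diff_add)
  then have sum: "P n + M + A' = G (Suc n)" using PA GV by (metis add.assoc)
  have dvdM: "Q dvd l s (P n + M) - l s K" for s
  proof -
    have "Q dvd (l s A - l s Y + l s X - floor_of K n s) - (l s A - floor_of K n s)" by (rule dvd_diff[OF AX(1) A(1)])
    moreover have "Q dvd l s (G n) - l s K" using ch nD by (simp add: chain_def)
    ultimately have "Q dvd ((l s A - l s Y + l s X - floor_of K n s) - (l s A - floor_of K n s)) + (l s (G n) - l s K)" by (rule dvd_add)
    moreover have "l s (G n) = l s (P n) + l s A" by (simp flip: PA)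
    ultimately show ?thesis by (simp add: lM algebra_simps)
  qed
  have NM: "N (P n + M) \<le> N (G n) + N (low e V)"
  proof -
    have "N M \<le> N A + N X" unfolding M_def using val_mono[of "A - Y" A p] by simp
    moreover have "N X \<le> N (low e V)" using X by (rule val_mono)
    moreover have "N (G n) = N (P n) + N A" by (simp flip: PA)
    ultimately show ?thesis by simp
  qed
  have M0: "P n \<subset># P n + M" if "0 < n"
  proof -
    have "Q \<le> l 0 M" using AX(2)[of 0] that by (simp add: floor_of_def lM)
    then have "M \<noteq> {#}" using Q_pos by auto
    then show ?thesis by (metis add_cancel_left_right mset_subset_eq_add_left subset_mset.le_neq_trans)
  qed
  have eA: "e \<in># A'" if "e \<in># G (Suc n) - G n"
  proof -
    have "e \<notin># X" using mset_subset_eqD[OF X] by (auto simp: low_def)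
    then have "e \<in># V - X" using that V_def by (metis in_diff_count not_in_iff in_diffD count_greater_zero_iff)
    then show ?thesis by (simp add: A'_def)
  qed
  have AB': "Q + Q \<le> l s A'" if bad: "l s z < w s e" and ge: "th K s + (int (Suc n) + 1) * Q \<le> l s (G (Suc n))" for s
  proof -
    have "2 * Q \<le> l s V \<or> floor_of K n s + Q \<le> l s A"
    proof (rule disjCI)
      assume "\<not> floor_of K n s + Q \<le> l s A"
      then have "\<not> th K s + (int n + 1) * Q \<le> l s (G n)" using AB[OF bad] by blast
      then have "Q < l s V" using ge unfolding GV by (simp add: algebra_simps)
      moreover have "Q dvd l s V - Q" using Vd(1) by simp
      ultimately show "2 * Q \<le> l s V" using dvd_gap by fastforce
    qed
    from VB[OF bad this] show ?thesis by (simp add: lA')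
  qed
  have "shifted K G e z (Suc n) P' A'" unfolding shifted_def
  proof (intro conjI allI impI)
    show "P' 0 = {#}" by (simp add: P'_def P0)
    show "P' (Suc n) + A' = G (Suc n)" by (simp add: P'_def sum)
    show "P' i \<subset># P' (Suc i)" if "0 < i \<and> i < Suc n" for i
      using that Pch[of i] M0 by (cases "i = n") (auto simp: P'_def)
    show "Q dvd l s (P' (Suc i)) - l s K" if "i < Suc n" for i s
      using that Pdvd[of i s] dvdM[of s] by (cases "i = n") (auto simp: P'_def)
    show "N (P' (Suc i)) \<le> N (G i) + N (low e (G (Suc i) - G i))" if "i < Suc n" for i
      using that PN[of i] NM by (cases "i = n") (auto simp: P'_def V_def)
    show "Q dvd l s A' - floor_of K (Suc n) s" for s using VX(1)[of s] by (simp add: floor_of_def lA')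
    show "floor_of K (Suc n) s \<le> l s A'" for s using VX(2)[of s] by (simp add: floor_of_def lA')
    show "floor_of K (Suc n) s + Q \<le> l s A'" if "l s z < w s e \<and> th K s + (int (Suc n) + 1) * Q \<le> l s (G (Suc n))" for s
      using AB'[of s] that by (simp add: floor_of_def)
    show "e \<in># A'" if "0 < Suc n \<and> e \<in># G (Suc n) - G (Suc n - 1)" using that eA by simp
  qed
  then show ?case by blast
qed

text \<open>
  Each low element is moved down by at most one step of the chain, so the added cost stays below
  \<open>v D * p ^ e\<close>, which is what removing \<open>e\<close> from the top saves.
\<close>

lemma cheaper_chain:
  assumes K: "\<And>x. count K x < p" and ch: "chain K D G" and D0: "0 < D"
    and e: "e \<in># G D - G (D - 1)"
    and B: "\<And>s. th K s + int D * Q \<le> l s (G D) - w s e + l s z"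
    and zdef: "z = low e (K - G D)"
    and C: "\<And>x s. x \<in># G D \<Longrightarrow> e < x \<Longrightarrow> w s x = 1 \<Longrightarrow> w s e \<le> l s z"
    and v: "\<And>i. i < D \<Longrightarrow> v i \<le> v D" and v0: "0 < v D"
  shows "\<exists>G'. chain K D G' \<and> cost v D G' < cost v D G"
proof -
  have z': "z \<subseteq># low e (K - G D)" by (simp add: zdef)
  have "\<exists>P A. shifted K G e z D P A" by (rule shift_chain[OF K ch order_refl D0 e z' B]) (rule C)
  then obtain P A where "shifted K G e z D P A" by blast
  note inv = this[unfolded shifted_def]
  have PA: "P D + A = G D" using inv by blast
  have Pch: "\<And>i. 0 < i \<Longrightarrow> i < D \<Longrightarrow> P i \<subset># P (Suc i)" using inv by blast
  have Pdvd: "\<And>i s. i < D \<Longrightarrow> Q dvd l s (P (Suc i)) - l s K" using inv by blast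
  have PN: "\<And>i. i < D \<Longrightarrow> N (P (Suc i)) \<le> N (G i) + N (low e (G (Suc i) - G i))" using inv by blast
  have fl: "floor_of K D s = Q" for s using D0 by (simp add: floor_of_def)
  have A: "\<And>s. Q \<le> l s A" using inv fl by metis
  have AB: "\<And>s. l s z < w s e \<Longrightarrow> th K s + (int D + 1) * Q \<le> l s (G D) \<Longrightarrow> Q + Q \<le> l s A" using inv fl by metis
  have eA: "e \<in># A" using inv D0 e by blast
  \<comment> \<open>Where \<open>z\<close> is too light to replace \<open>e\<close>, hypothesis
    \<open>B\<close> forces a surplus of one \<open>Q\<close> in \<open>G D\<close>, and the shift
    has brought it into \<open>A\<close>; elsewhere \<open>z\<close> pays for
    \<open>e\<close>.\<close>
  have AZ: "0 + int 1 * Q \<le> l s (A - {#e#} + z)" for s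
  proof (cases "l s z < w s e")
    case True
    then have "th K s + int D * Q < l s (G D)" using B[of s] by linarith
    from dvd_gap[OF chain_dvd[OF ch order_refl] this] 
    have "th K s + (int D + 1) * Q \<le> l s (G D)" by (simp add: algebra_simps)
    from AB[OF True this] show ?thesis using eA w_le[of s e] l_nonneg[of s z] by simp
  next
    case False
    then show ?thesis using eA A[of s] by simp
  qed
  have "\<exists>M. M \<subseteq># A - {#e#} + z \<and> (\<forall>s. Q dvd l s M - 0 \<and> 0 + int 1 * Q \<le> l s M)"
    by (rule ex_residual_sub[OF residual_const(1)]) (rule AZ)
  then obtain M where M: "M \<subseteq># A - {#e#} + z" "\<And>s. Q dvd l s M" "\<And>s. Q \<le> l s M" by auto
  define G' where "G' i = (if i = D then P D + M else P (Suc i))" for i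
  have zK: "z \<subseteq># K - G D" using zdef low_sub by simp
  have GDK: "G D \<subseteq># K" using ch by (simp add: chain_def)
  have eGD: "e \<in># G D" using e by (rule in_diffD)
  have sub: "P D + M \<subseteq># (G D - {#e#}) + z"
  proof -
    have "P D + M \<subseteq># P D + (A - {#e#} + z)" using M(1) by (simp add: subset_mset.add_left_mono)
    also have "\<dots> = (G D - {#e#}) + z" using eA by (simp flip: PA add: add.assoc)
    finally show ?thesis .
  qed
  have M0: "M \<noteq> {#}" using M(3)[of 0] Q_pos by auto
  have "chain K D G'" unfolding chain_def
  proof (intro conjI allI impI)
    fix i assume i: "i < D"
    show "G' i \<subset># G' (Suc i)"
    proof (cases "Suc i = D")
      case True
      have "P D \<subset># P D + M" using M0 
        by (metis add_cancel_left_right mset_subset_eq_add_left subset_mset.le_neq_trans)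
      then show ?thesis using i True by (simp add: G'_def)
    next
      case False
      then show ?thesis using i Pch[of "Suc i"] by (simp add: G'_def)
    qed
  next
    have "(G D - {#e#}) + z \<subseteq># G D + (K - G D)" using zK by (intro subset_mset.add_mono) auto
    also have "\<dots> = K" using GDK by (simp add: subset_mset.add_diff_inverse)
    finally show "G' D \<subseteq># K" using sub by (auto simp: G'_def intro: subset_mset.order_trans)
  next
    fix i s assume i: "i \<le> D"
    show "Q dvd l s (G' i) - l s K"
    proof (cases "i = D")
      case True
      have "Q dvd l s (P D) - l s K" using Pdvd[of "D - 1" s] D0 by simp
      then have "Q dvd (l s (P D) - l s K) + l s M" using M(2) by (rule dvd_add)
      then show ?thesis using True by (simp add: G'_def algebra_simps)
    next
      case False
      then show ?thesis using i Pdvd[of i s] by (simp add: G'_def)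
    qed
  qed
  moreover have "cost v D G' < cost v D G"
  proof -
    let ?L = "\<lambda>i. N (low e (G (Suc i) - G i))"
    have split: "cost v D F = (\<Sum>i<D. v i * N (F i)) + v D * N (F D)" for F
      unfolding cost_def by (simp add: lessThan_Suc_atMost[symmetric])
    have 1: "(\<Sum>i<D. v i * N (G' i)) \<le> (\<Sum>i<D. v i * N (G i)) + v D * (\<Sum>i<D. ?L i)"
    proof -
      have "(\<Sum>i<D. v i * N (G' i)) \<le> (\<Sum>i<D. v i * N (G i) + v D * ?L i)"
      proof (rule sum_mono)
        fix i assume "i \<in> {..<D}"
        then have i: "i < D" by simp
        have "v i * N (G' i) \<le> v i * (N (G i) + ?L i)" using PN[OF i] i by (simp add: G'_def)
        also have "\<dots> \<le> v i * N (G i) + v D * ?L i" using v[OF i] by (simp add: distrib_left)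
        finally show "v i * N (G' i) \<le> v i * N (G i) + v D * ?L i" .
      qed
      then show ?thesis by (simp add: sum.distrib sum_distrib_left)
    qed
    have "N (G' D) \<le> N ((G D - {#e#}) + z)" using val_mono[OF sub, of p] by (simp add: G'_def)
    moreover have "N (G D) = p ^ e + N (G D - {#e#})" using eGD by (metis insert_DiffM val_simps(2))
    ultimately have 2: "N (G' D) + p ^ e \<le> N (G D) + N z" by simp
    \<comment> \<open>The low parts of the differences and \<open>z\<close> are disjoint pieces of
      the low part of \<open>K\<close>.\<close>
    have "(\<Sum>i<D. ?L i) + N z < p ^ e"
    proof -
      have "(\<Sum>i<D. ?L i) \<le> N (low e (G D))"
        using low_telescope[of D G e] chain_mono[OF ch, of _ "Suc _"] by fastforce
      moreover have "low e (G D) + z = low e K" 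
        using zdef GDK by (metis low_add subset_mset.add_diff_inverse)
      then have "N (low e (G D)) + N z = N (low e K)" by (metis val_simps(3))
      moreover have "N (low e K) < p ^ e" by (rule val_low_less[OF K]) simp
      ultimately show ?thesis by simp
    qed
    then have "v D * (N (G' D) + (\<Sum>i<D. ?L i)) < v D * N (G D)" using 2 v0 by (intro mult_strict_left_mono) auto
    then show ?thesis unfolding split using 1 by (simp add: distrib_left)
  qed
  ultimately show ?thesis by blast
qed

section \<open>Optimal chains have the least possible top\<close>

lemma ex_optimal:
  assumes "chain K D G"
  shows "\<exists>G'. chain K D G' \<and> (\<forall>H. chain K D H \<longrightarrow> cost v D G' \<le> cost v D H)"
  using ex_has_least_nat[of "chain K D" G "cost v D"] assms by auto

lemma cost_Suc: "cost v (Suc D) G = cost v D G + v (Suc D) * N (G (Suc D))"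
  by (simp add: cost_def)

lemma cost_upd: 
  "cost (v(D := v D + a)) D G = cost v D G + a * N (G D)"
  unfolding cost_def lessThan_Suc_atMost[symmetric] by (simp add: distrib_right)

lemma cost_cong: "(\<And>i. i \<le> D \<Longrightarrow> G i = H i) \<Longrightarrow> cost v D G = cost v D H"
  by (simp add: cost_def)

lemma chain_base:
  assumes "\<And>s. Q dvd l s K' - l s K" "G D \<subseteq># K'" "chain K D G"
  shows "chain K' D G"
  unfolding chain_def
proof (intro conjI allI impI)
  fix i s assume "i \<le> D"
  then have "Q dvd l s (G i) - l s K" using assms(3) by (simp add: chain_def)
  then have "Q dvd (l s (G i) - l s K) - (l s K' - l s K)" using assms(1) by (rule dvd_diff)
  then show "Q dvd l s (G i) - l s K'" by simp
qed (use assms in \<open>auto simp: chain_def\<close>)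

lemma th_base: "(\<And>s. Q dvd l s K' - l s K) \<Longrightarrow> th K' s = th K s"
  by (simp add: mod_eq_dvd_iff)

text \<open>
  Let \<open>B'\<close> be the smallest competitor and \<open>e\<close> the highest position in which it differs from \<open>G (Suc D)\<close>.
  If \<open>e\<close> lies in the last difference \<open>V\<close>, the chain can be made cheaper. Otherwise the induction
  hypothesis, applied to the truncated chain both inside \<open>G (Suc D)\<close> and inside \<open>K - V\<close>, yields an index
  \<open>s\<close> at which neither the low part of \<open>V\<close> nor that of \<open>K - G (Suc D)\<close> outweighs \<open>e\<close>, and then the
  high part of \<open>V\<close> is too heavy. Weights \<open>v\<close> other than \<open>1\<close> are needed only for passing to \<open>K - V\<close>.
\<close>

lemma top_minimal:
  assumes "\<And>x. count K x < p" "\<And>i. i < D \<Longrightarrow> v i \<le> v (Suc i)" "0 < v 0"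
    and "chain K D G" "\<And>H. chain K D H \<Longrightarrow> cost v D G \<le> cost v D H"
    and "B \<subseteq># K" "\<And>s. th K s + int D * Q \<le> l s B"
  shows "N (G D) \<le> N B"
  using assms
proof (induction D arbitrary: K v G B)
  case 0
  obtain H where H: "chain K 0 H" "H 0 \<subseteq># B" using chain_ext[of B K 0] 0 by auto
  have "v 0 * N (G 0) \<le> v 0 * N (H 0)" using 0(5)[OF H(1)] by (simp add: cost_def)
  then show ?case using val_mono[OF H(2), of p] 0(3) by simp
next
  case (Suc D)
  note K = Suc.prems(1) and v = Suc.prems(2) and v0 = Suc.prems(3) and ch = Suc.prems(4) and opt = Suc.prems(5)
  show ?case
  proof (rule ccontr)
    assume "\<not> ?thesis"
    then have NB: "N B < N (G (Suc D))" by simp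
    let ?F = "\<lambda>B. B \<subseteq># K \<and> (\<forall>s. th K s + int (Suc D) * Q \<le> l s B)"
    obtain B' where B': "?F B'" "\<And>C. ?F C \<Longrightarrow> N B' \<le> N C"
      using ex_has_least_nat[of ?F B N] Suc.prems(6,7) by blast
    have "N B' < N (G (Suc D))" using B'(2)[of B] Suc.prems(6,7) NB by (meson le_less_trans)
    have GK: "G (Suc D) \<subseteq># K" using ch by (simp add: chain_def)
    have subK: "count M x < p" if "M \<subseteq># K" for M x
      using mset_subset_eq_count[OF that, of x] K[of x] by simp
    obtain e where e: "count B' e < count (G (Suc D)) e" 
        and top: "\<And>x. e < x \<Longrightarrow> count B' x = count (G (Suc D)) x"
      using val_less_top[OF subK subK \<open>N B' < N (G (Suc D))\<close>] B'(1) GK by blast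
    define z where "z = low e (K - G (Suc D))"
    define V where "V = G (Suc D) - G D"
    have zK: "z \<subseteq># K - G (Suc D)" by (simp add: z_def low_sub)
    have eG: "e \<in># G (Suc D)" using e by (simp add: count_greater_zero_iff[symmetric] del: count_greater_zero_iff)
    have B'sub: "B' \<subseteq># G (Suc D) - {#e#} + z"
    proof (rule mset_subset_eqI)
      fix x
      have "count B' x \<le> count K x" using B'(1) by (simp add: mset_subset_eq_count)
      moreover have "count (G (Suc D)) x \<le> count K x" using GK by (rule mset_subset_eq_count)
      ultimately show "count B' x \<le> count (G (Suc D) - {#e#} + z) x"
        using e top[of x] by (cases "x < e"; cases "x = e") (auto simp: z_def low_def)
    qed
    have FB: "th K s + int (Suc D) * Q \<le> l s (G (Suc D)) - w s e + l s z" for s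
      using l_mono[OF B'sub, of s] B'(1)[THEN conjunct2, rule_format, of s] eG by simp
    \<comment> \<open>Trading a higher \<open>x\<close> for \<open>z\<close> gives a value below
      that of \<open>B'\<close>, so by minimality the result is too light at some
      \<open>\<sigma>\<close>. There \<open>G (Suc D)\<close> has no surplus, since a surplus
      \<open>Q\<close> would pay for \<open>x\<close>.\<close>
    have FC: "\<exists>\<sigma>. w \<sigma> e \<le> l \<sigma> z \<and> l \<sigma> z < w \<sigma> x \<and> l \<sigma> (G (Suc D)) = th K \<sigma> + int (Suc D) * Q"
      if x: "x \<in># G (Suc D)" "e < x" for x
    proof -
      let ?M = "G (Suc D) - {#x#} + z"
      have "?M \<subseteq># G (Suc D) + (K - G (Suc D))" using zK by (intro subset_mset.add_mono) auto
      then have MK: "?M \<subseteq># K" using GK by (simp add: subset_mset.add_diff_inverse)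
      have cz: "count z y = 0" if "e \<le> y" for y using that by (simp add: z_def low_def)
      have "N ?M < N B'"
      proof (rule val_less[where e = x])
        show "count ?M y < p" for y by (rule subK[OF MK])
        show "count ?M y = count B' y" if "x < y" for y using that x cz[of y] top[of y] by simp
        have "0 < count (G (Suc D)) x" using x by simp
        then show "count ?M x < count B' x" using x cz[of x] top[of x] by simp
      qed
      then have "\<not> ?F ?M" using B'(2) by (meson not_le)
      then obtain \<sigma> where "l \<sigma> ?M < th K \<sigma> + int (Suc D) * Q" using MK by (meson not_le)
      then have \<sigma>: "l \<sigma> (G (Suc D)) - w \<sigma> x + l \<sigma> z < th K \<sigma> + int (Suc D) * Q" using x by simp
      have lo: "th K \<sigma> + int (Suc D) * Q \<le> l \<sigma> (G (Suc D))" by (rule chain_lower[OF ch order_refl])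
      have "l \<sigma> (G (Suc D)) = th K \<sigma> + int (Suc D) * Q"
      proof (rule ccontr)
        assume "\<not> ?thesis"
        then have "th K \<sigma> + int (Suc D) * Q < l \<sigma> (G (Suc D))" using lo by simp
        from dvd_gap[OF chain_dvd[OF ch order_refl] this] show False
          using \<sigma> w_le[of \<sigma> x] l_nonneg[of \<sigma> z] by linarith
      qed
      then show ?thesis using \<sigma> FB[of \<sigma>] by (intro exI[of _ \<sigma>]) linarith
    qed
    have GG: "G D \<subset># G (Suc D)" using ch by (simp add: chain_def)
    then have GG': "G D \<subseteq># G (Suc D)" by (simp add: subset_mset.less_imp_le)
    have VG: "V + G D = G (Suc D)" using GG' by (simp add: V_def)
    have V0: "V \<noteq> {#}" using GG by (simp add: V_def Diff_eq_empty_iff_mset subset_mset.less_le_not_le)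
    have Vdvd: "Q dvd l s V" "Q \<le> l s V" for s using chain_diff[OF ch, of D s] by (auto simp: V_def)
    have chD: "chain K D G" using ch GG' unfolding chain_def by (auto intro: subset_mset.order_trans)
    have GDK: "G D \<subseteq># K" using chD by (simp add: chain_def)
    have ext: "chain K (Suc D) (H(Suc D := M))" 
      if "chain K D H" "H D \<subset># M" "M \<subseteq># K" "\<And>s. Q dvd l s M - l s K" for H M
      using that by (auto simp: chain_def less_Suc_eq le_Suc_eq)
    have costext: "cost v (Suc D) (H(Suc D := M)) = cost v D H + v (Suc D) * N M" for H M
      by (simp add: cost_Suc cong: cost_cong)
    have eV: "e \<in># V"
    proof (rule ccontr)
      assume eV: "e \<notin># V"
      have "count (G (Suc D)) e = count V e + count (G D) e" by (simp flip: VG)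
      then have eD: "e \<in># G D" using eG eV by (simp add: not_in_iff count_greater_zero_iff[symmetric] del: count_greater_zero_iff)
      \<comment> \<open>The induction hypothesis read backwards: trading \<open>e\<close> for
        \<open>low e A\<close> gives a value below that of the optimal top \<open>G D\<close>, so
        the result is too light at some \<open>s\<close>.\<close>
      have lower: "\<exists>s. l s (low e A) < w s e \<and> l s (G D) = th K s + int D * Q"
        if A: "low e A \<subseteq># K'" and G: "G D + low e A \<subseteq># K'" and K': "K' \<subseteq># K" "\<And>s. Q dvd l s K' - l s K"
          and v': "\<And>i. i < D \<Longrightarrow> v' i \<le> v' (Suc i)" "0 < v' 0"
          and opt': "\<And>H. chain K' D H \<Longrightarrow> cost v' D G \<le> cost v' D H"
        for K' A v'
      proof -
        let ?M = "G D - {#e#} + low e A"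
        have "?M \<subseteq># G D + low e A" by (simp add: subset_mset.add_mono)
        then have MK: "?M \<subseteq># K'" using G by (rule subset_mset.order_trans)
        have "G D \<subseteq># K'" using G by (meson mset_subset_eq_add_left subset_mset.order_trans)
        then have chK': "chain K' D G" using chD by (rule chain_base[OF K'(2)])
        have "N (low e A) < p ^ e"
        proof (rule val_low_less)
          show "count K' x < p" for x by (rule subK[OF K'(1)])
          have "low e (low e A) = low e A" by (simp add: low_def filter_filter_mset)
          then show "low e A \<subseteq># low e K'" using A unfolding low_def by (metis multiset_filter_mono)
        qed
        moreover have "N (G D) = p ^ e + N (G D - {#e#})" using eD by (metis insert_DiffM val_simps(2))
        ultimately have "N ?M < N (G D)" by simp
        then have "\<not> (\<forall>s. th K' s + int D * Q \<le> l s ?M)"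
          using Suc.IH[OF subK[OF K'(1)] v' chK' opt' MK] by (meson not_le)
        then obtain s where s: "l s ?M < th K s + int D * Q" unfolding th_base[OF K'(2)] by (meson not_le)
        then have s': "l s (G D) - w s e + l s (low e A) < th K s + int D * Q" using eD by simp
        have lo: "th K s + int D * Q \<le> l s (G D)" by (rule chain_lower[OF chD order_refl])
        have "l s (G D) = th K s + int D * Q"
        proof (rule ccontr)
          assume "\<not> ?thesis"
          then have "th K s + int D * Q < l s (G D)" using lo by simp
          from dvd_gap[OF chain_dvd[OF chD order_refl] this] show False
            using s' w_le[of s e] l_nonneg[of s "low e A"] by linarith
        qed
        then show ?thesis using s' by (intro exI[of _ s]) linarith
      qed
      have "\<exists>s. l s (low e V) < w s e \<and> l s (G D) = th K s + int D * Q"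
      proof (rule lower)
        have *: "low e V \<subseteq># V" by (rule low_sub)
        show "low e V \<subseteq># G (Suc D)" using * by (simp add: V_def) (meson diff_subset_eq_self subset_mset.order_trans)
        show "G D + low e V \<subseteq># G (Suc D)" using * by (simp flip: VG add: add.commute)
        show "Q dvd l s (G (Suc D)) - l s K" for s using ch by (simp add: chain_def)
        fix H assume H: "chain (G (Suc D)) D H"
        obtain H' where H': "chain (G (Suc D)) D H'" "\<And>H. chain (G (Suc D)) D H \<Longrightarrow> cost v D H' \<le> cost v D H"
          using ex_optimal[OF H, of v] by blast
        have dv: "Q dvd l s K - l s (G (Suc D))" "Q dvd l s (G (Suc D)) - l s K" for s 
          using ch by (auto simp: chain_def dvd_diff_commute)
        have thG: "th (G (Suc D)) s = th K s" for s by (rule th_base[OF dv(2)])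
        \<comment> \<open>An optimal chain inside \<open>G (Suc D)\<close> might have
          \<open>G (Suc D)\<close> as its top and then could not be extended by it. The induction
          hypothesis, with \<open>G D\<close> as competitor, rules this out.\<close>
        have "N (H' D) \<le> N (G D)"
        proof (rule Suc.IH)
          show "count (G (Suc D)) x < p" for x by (rule subK[OF GK])
          show "th (G (Suc D)) s + int D * Q \<le> l s (G D)" for s
            unfolding thG by (rule chain_lower[OF chD order_refl])
        qed (use v v0 H' GG' in auto)
        also have "N (G D) < N (G (Suc D))"
        proof -
          obtain y where "y \<in># V" using V0 by (meson multiset_nonemptyE)
          then have "p ^ y \<le> N V" by (metis le_add1 multi_member_split val_simps(2))
          then show ?thesis using p2 by (simp flip: VG) (metis le_0_eq neq0_conv not_numeral_le_zero power_eq_0_iff)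
        qed
        finally have "H' D \<noteq> G (Suc D)" by auto
        then have "H' D \<subset># G (Suc D)" using H'(1) by (simp add: chain_def subset_mset.le_neq_trans)
        moreover have "chain K D H'"
        proof (rule chain_base[OF dv(1) _ H'(1)])
          show "H' D \<subseteq># K" using H'(1) GK by (auto simp: chain_def intro: subset_mset.order_trans)
        qed
        ultimately have "chain K (Suc D) (H'(Suc D := G (Suc D)))" using GK dv(2) by (intro ext)
        then have "cost v (Suc D) G \<le> cost v D H' + v (Suc D) * N (G (Suc D))"
          using opt costext by metis
        then have "cost v D G \<le> cost v D H'" by (simp add: cost_Suc)
        also have "\<dots> \<le> cost v D H" by (rule H'(2)[OF H])
        finally show "cost v D G \<le> cost v D H" .
      qed (use v v0 GK in auto)
      then obtain s2 where s2: "l s2 (low e V) < w s2 e" "l s2 (G D) = th K s2 + int D * Q" by blast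
      have "\<exists>s. l s (low e (K - G (Suc D))) < w s e \<and> l s (G D) = th K s + int D * Q"
      \<comment> \<open>Every chain inside \<open>K - V\<close> extends by its own top plus
        \<open>V\<close>. Up to the constant \<open>v (Suc D) * N V\<close>, the extension counts
        that top with weight \<open>v D + v (Suc D)\<close>.\<close>
      proof (rule lower[where v' = "v(D := v D + v (Suc D))"])
        have *: "G D + (K - G (Suc D)) = K - V" using GK by (simp flip: VG)
        show "low e (K - G (Suc D)) \<subseteq># K - V" unfolding *[symmetric] using zK z_def
          by (metis mset_subset_eq_add_right subset_mset.order_trans)
        show sub: "G D + low e (K - G (Suc D)) \<subseteq># K - V" unfolding *[symmetric] using zK z_def
          by (simp add: subset_mset.add_left_mono)
        show "K - V \<subseteq># K" by simp
        have VK: "V \<subseteq># K" using GK VG by (metis mset_subset_eq_add_left subset_mset.order_trans)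
        show dv: "Q dvd l s (K - V) - l s K" for s using Vdvd(1)[of s] VK by simp
        show "(v(D := v D + v (Suc D))) i \<le> (v(D := v D + v (Suc D))) (Suc i)" if "i < D" for i
          using v[of i] that by auto
        show "0 < (v(D := v D + v (Suc D))) 0" using v0 by simp
        fix H assume H: "chain (K - V) D H"
        have "Q dvd l s K - l s (K - V)" for s using dv[of s] by (simp add: dvd_diff_commute)
        moreover have HK: "H D \<subseteq># K - V" using H by (simp add: chain_def)
        then have "H D \<subseteq># K" by (meson diff_subset_eq_self subset_mset.order_trans)
        ultimately have HK': "chain K D H" using H by (rule chain_base)
        have "H D + V \<subseteq># K" using HK VK by (metis subset_mset.add_right_mono subset_mset.diff_add)
        moreover have "H D \<subset># H D + V" using V0 by (metis add_cancel_left_right mset_subset_eq_add_left subset_mset.le_neq_trans)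
        moreover have "Q dvd l s (H D + V) - l s K" for s
        proof -
          have "Q dvd (l s (H D) - l s K) + l s V" using HK' Vdvd(1) unfolding chain_def by (intro dvd_add) auto
          then show ?thesis by (simp add: algebra_simps)
        qed
        ultimately have "chain K (Suc D) (H(Suc D := H D + V))" using HK' by (intro ext)
        then have "cost v (Suc D) G \<le> cost v D H + v (Suc D) * N (H D + V)"
          using opt costext by metis
        moreover have "N (G (Suc D)) = N V + N (G D)" by (simp flip: VG)
        ultimately show "cost (v(D := v D + v (Suc D))) D G \<le> cost (v(D := v D + v (Suc D))) D H"
          unfolding cost_upd by (simp add: cost_Suc distrib_left)
      qed
      then obtain s1 where s1: "l s1 z < w s1 e" "l s1 (G D) = th K s1 + int D * Q" unfolding z_def by blast
      obtain s where s: "l s z < w s e" "l s (low e V) < w s e" "l s (G D) = th K s + int D * Q"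
        using bad_nested[OF s1(1) s2(1)] s1 s2 by blast
      have lV: "l s V + l s (G D) = l s (G (Suc D))" for s by (simp flip: VG)
      have "Q < l s V" using FB[of s] lV[of s] s by (simp add: algebra_simps)
      moreover have "Q dvd l s V - Q" using Vdvd(1) by simp
      ultimately have V2: "Q + Q \<le> l s V" by (intro dvd_gap)
      define h where "h = {#x \<in># V. e < x#}"
      have "V = low e V + h"
        using eV by (intro multiset_eqI) (auto simp: low_def h_def not_in_iff linorder_neq_iff[of _ e])
      then have lh: "l s V = l s (low e V) + l s h" for s by (metis lv_simps(3))
      show False
      proof (rule high_part_contradiction[OF s(1)])
        show "Q < l s h" using V2 lh[of s] s(2) w_le[of s e] by linarith
        fix x assume "x \<in># h"
        then have x: "x \<in># V" "e < x" by (auto simp: h_def)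
        then have "x \<in># G (Suc D)" by (metis VG union_iff)
        then obtain \<sigma> where \<sigma>: "w \<sigma> e \<le> l \<sigma> z" "l \<sigma> z < w \<sigma> x" "l \<sigma> (G (Suc D)) = th K \<sigma> + int (Suc D) * Q"
          using FC x(2) by blast
        have "th K \<sigma> + int D * Q \<le> l \<sigma> (G D)" by (rule chain_lower[OF chD order_refl])
        then have "l \<sigma> V \<le> Q" using lV[of \<sigma>] \<sigma>(3) by (simp add: algebra_simps)
        then have "l \<sigma> h \<le> Q" using lh[of \<sigma>] l_nonneg[of \<sigma> "low e V"] by linarith
        then show "\<exists>\<sigma>. w \<sigma> e \<le> l \<sigma> z \<and> l \<sigma> z < w \<sigma> x \<and> l \<sigma> h \<le> Q" using \<sigma> by blast
      qed
    qed
    have "\<exists>G'. chain K (Suc D) G' \<and> cost v (Suc D) G' < cost v (Suc D) G"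
    proof (rule cheaper_chain[OF K ch _ _ FB z_def])
      show "e \<in># G (Suc D) - G (Suc D - 1)" using eV by (simp add: V_def)
      show "w s e \<le> l s z" if "x \<in># G (Suc D)" "e < x" "w s x = 1" for x s
        using FC[OF that(1,2)] not_bad that(3) by blast
      have mono: "v i \<le> v j" if "i \<le> j" "j \<le> Suc D" for i j
        using that
      proof (induction j rule: dec_induct)
        case (step n) then show ?case using v[of n] by simp
      qed simp
      show "v i \<le> v (Suc D)" if "i < Suc D" for i using mono[of i "Suc D"] that by simp
      show "0 < v (Suc D)" using mono[of 0 "Suc D"] v0 by simp
    qed simp
    then show False using opt by (meson not_le)
  qed
qed

section \<open>Chains of natural numbers\<close>

definition dig :: "nat \<Rightarrow> nat multiset" where
  "dig k = (\<Sum>e\<le>k. replicate_mset (k div p ^ e mod p) e)"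

lemma count_dig: "count (dig k) e = k div p ^ e mod p"
proof -
  have "count (dig k) e = (\<Sum>i\<le>k. if i = e then k div p ^ i mod p else 0)"
    by (auto simp: dig_def count_sum intro!: sum.cong)
  also have "\<dots> = k div p ^ e mod p"
  proof (cases "e \<le> k")
    case False
    have "k < p ^ k" using p2 by (intro power_gt_expt) simp
    also have "\<dots> \<le> p ^ e" using False p2 by (intro power_increasing) auto
    finally show ?thesis using False by simp
  qed simp
  finally show ?thesis .
qed

lemma count_dig_less: "count (dig k) e < p"
  using p2 by (simp add: count_dig)

lemma digit_expansion: "(\<Sum>e<n. (k div p ^ e mod p) * p ^ e) = k mod p ^ n"
proof (induction n)
  case (Suc n)
  have "k mod (p ^ n * p) = p ^ n * (k div p ^ n mod p) + k mod p ^ n" by (rule mod_mult2_eq)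
  then show ?case using Suc by (simp add: mult.commute)
qed simp

lemma val_dig [simp]: "N (dig k) = k"
proof -
  have rep: "N (replicate_mset m e) = m * p ^ e" for m e by (induction m) auto
  have sum: "N (\<Sum>i\<in>A. F i) = (\<Sum>i\<in>A. N (F i))" if "finite A" for A and F :: "nat \<Rightarrow> nat multiset"
    using that by (induction A rule: finite_induct) auto
  have "N (dig k) = (\<Sum>e<Suc k. (k div p ^ e mod p) * p ^ e)"
    by (simp add: dig_def sum rep lessThan_Suc_atMost)
  also have "\<dots> = k mod p ^ Suc k" by (rule digit_expansion)
  also have "\<dots> = k" 
  proof -
    have "k < p ^ k" using p2 by (intro power_gt_expt) simp
    also have "\<dots> \<le> p ^ Suc k" using p2 by (intro power_increasing) auto
    finally show ?thesis by simp
  qed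
  finally show ?thesis .
qed

lemma dig_val: "(\<And>e. count M e < p) \<Longrightarrow> dig (N M) = M"
  by (rule val_inj[OF count_dig_less]) simp_all

lemma dig_val_sub: "M \<subseteq># dig k \<Longrightarrow> dig (N M) = M"
  by (rule dig_val) (meson count_dig_less le_less_trans mset_subset_eq_count)

lemma dig_inject: "dig j = dig k \<longleftrightarrow> j = k"
  by (metis val_dig)

lemma Q_dvd_power: "Q dvd int p ^ e - w 0 e"
proof -
  have "int p ^ e = int p ^ (f * (e div f) + e mod f)" by simp
  also have "\<dots> = (int p ^ f) ^ (e div f) * int p ^ (e mod f)" by (simp only: power_add power_mult)
  finally have "int p ^ e - w 0 e = ((int p ^ f) ^ (e div f) - 1) * int p ^ (e mod f)"
    by (simp add: wt_def nat_mod_as_int left_diff_distrib)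
  moreover have "Q dvd (int p ^ f) ^ (e div f) - 1" by (simp add: Q_def power_diff_1_eq)
  ultimately show ?thesis by simp
qed

lemma Q_dvd_val: "Q dvd int (N M) - l 0 M"
proof (induction M)
  case (add e M)
  have "Q dvd (int p ^ e - w 0 e) + (int (N M) - l 0 M)" using Q_dvd_power add by (rule dvd_add)
  then show ?case by (simp add: algebra_simps)
qed simp

text \<open>Modulo \<open>Q\<close>, \<open>l_step\<close> multiplies \<open>lv\<close> by
  \<open>p\<close>, so a congruence at one index spreads to all. For this reason the condition over
  all \<open>s\<close> in \<open>chain\<close> amounts to one congruence of values modulo
  \<open>q - 1\<close>.\<close>

lemma lv_diff_dvd:
  assumes "Q dvd l 0 A - l 0 B" shows "Q dvd l s A - l s B"
proof -
  have "Q dvd l (int n) A - l (int n) B" for n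
  proof (induction n)
    case (Suc n)
    have "Q dvd int p * (l (int n) A - l (int n) B) - Q * (c (int n) A - c (int n) B)"
      using Suc by (intro dvd_diff) auto
    moreover have "l (int (Suc n)) A - l (int (Suc n)) B = int p * (l (int n) A - l (int n) B) - Q * (c (int n) A - c (int n) B)"
      using l_step[of "int n" A] l_step[of "int n" B] by (simp add: algebra_simps)
    ultimately show ?case by simp
  qed (use assms in simp)
  from this[of "nat (s mod int f)"] have "Q dvd l (s mod int f) A - l (s mod int f) B" using f0 by simp
  then show ?thesis using l_mod[of "s mod int f" s] by simp
qed

lemma lv_diff_dvd_iff: "(\<forall>s. Q dvd l s A - l s B) \<longleftrightarrow> Q dvd int (N A) - int (N B)"
proof
  assume "\<forall>s. Q dvd l s A - l s B"
  then have "Q dvd (int (N A) - l 0 A) - (int (N B) - l 0 B) + (l 0 A - l 0 B)"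
    using dvd_add[OF dvd_diff[OF Q_dvd_val Q_dvd_val]] by blast
  then show "Q dvd int (N A) - int (N B)" by simp
next
  assume "Q dvd int (N A) - int (N B)"
  then have "Q dvd (int (N A) - int (N B)) - ((int (N A) - l 0 A) - (int (N B) - l 0 B))"
    using dvd_diff[OF _ dvd_diff[OF Q_dvd_val Q_dvd_val]] by blast
  then show "\<forall>s. Q dvd l s A - l s B" by (auto intro: lv_diff_dvd)
qed

section \<open>Exponent sums of descending chains\<close>

definition descent :: "nat \<Rightarrow> nat \<Rightarrow> bool" where
  "descent k j \<longleftrightarrow> j < k \<and> Q dvd int j - int k \<and> dig j \<subseteq># dig k"

lemma descent_trans: "descent k j \<Longrightarrow> descent j i \<Longrightarrow> descent k i"
proof -
  assume a: "descent k j" "descent j i"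
  then have "Q dvd (int i - int j) + (int j - int k)" unfolding descent_def by (intro dvd_add) auto
  then show ?thesis using a by (auto simp: descent_def intro: subset_mset.order_trans)
qed

text \<open>The sums \<open>h_1 + ... + h_d\<close> over descending chains from \<open>k\<close>,
  which are the exponents of \<open>t\<close> that the recursion can produce in
  \<open>S_d(-k)\<close>; \<open>k\<close> itself is not counted.\<close>

fun costs :: "nat \<Rightarrow> nat \<Rightarrow> nat set" where
  "costs 0 k = {0}"
| "costs (Suc d) k = {j + m | j m. descent k j \<and> m \<in> costs d j}"

lemma costs_chain:
  assumes "descent k j" "m \<in> costs D j"
  shows "\<exists>G. chain (dig k) D G \<and> G D = dig j \<and> cost (\<lambda>_. 1) D G = j + m"
  using assms
proof (induction D arbitrary: k j m)
  case 0
  then show ?case by (intro exI[of _ "\<lambda>_. dig j"]) (auto simp: chain_def cost_def descent_def lv_diff_dvd_iff)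
next
  case (Suc D)
  then obtain i m' where i: "descent j i" "m' \<in> costs D i" "m = i + m'" by auto
  from Suc.IH[OF this(1,2)] obtain G where G: "chain (dig j) D G" "G D = dig i" "cost (\<lambda>_. 1) D G = i + m'" by blast
  have "\<forall>s. Q dvd l s (dig j) - l s (dig k)" using Suc.prems by (simp add: descent_def lv_diff_dvd_iff)
  then have kj: "Q dvd l s (dig k) - l s (dig j)" "Q dvd l s (dig j) - l s (dig k)" for s by (auto simp: dvd_diff_commute)
  have sub: "dig j \<subseteq># dig k" using Suc.prems by (simp add: descent_def)
  have "G D \<subseteq># dig k" using G(1) sub by (auto simp: chain_def intro: subset_mset.order_trans)
  then have 1: "chain (dig k) D G" by (rule chain_base[OF kj(1) _ G(1)])
  have "G D \<subset># dig j" using i(1) unfolding G(2) descent_def by (auto simp: subset_mset.less_le dig_inject)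
  then have "chain (dig k) (Suc D) (G(Suc D := dig j))"
    using 1 sub kj(2) by (auto simp: chain_def less_Suc_eq le_Suc_eq)
  moreover have "cost (\<lambda>_. 1) (Suc D) (G(Suc D := dig j)) = cost (\<lambda>_. 1) D G + j"
    by (simp add: cost_Suc cong: cost_cong)
  moreover have "(G(Suc D := dig j)) (Suc D) = dig j" by simp
  ultimately show ?case using G(3) i(3) by (metis add.commute)
qed

lemma chain_costs:
  assumes "chain (dig k) D G" "G D \<noteq> dig k"
  shows "descent k (N (G D)) \<and> (\<exists>m\<in>costs D (N (G D)). cost (\<lambda>_. 1) D G = N (G D) + m)"
  using assms
proof (induction D arbitrary: k)
  case 0
  have "G 0 \<subset># dig k" using 0 by (auto simp: chain_def subset_mset.less_le)
  moreover from this have "dig (N (G 0)) = G 0" by (intro dig_val_sub[of _ k]) (simp add: subset_mset.less_imp_le)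
  moreover have "N (G 0) < k" 
  proof -
    have "N (G 0) \<le> N (dig k)" using \<open>G 0 \<subset># dig k\<close> by (intro val_mono) (simp add: subset_mset.less_imp_le)
    moreover have "N (G 0) \<noteq> k" using 0(2) \<open>dig (N (G 0)) = G 0\<close> by auto
    ultimately show ?thesis by simp
  qed
  moreover have "\<forall>s. Q dvd l s (G 0) - l s (dig k)" using 0 by (simp add: chain_def)
  ultimately show ?case by (auto simp: descent_def cost_def lv_diff_dvd_iff subset_mset.less_imp_le)
next
  case (Suc D)
  let ?j = "N (G (Suc D))"
  have sub: "G (Suc D) \<subset># dig k" using Suc.prems by (auto simp: chain_def subset_mset.less_le)
  then have dj: "dig ?j = G (Suc D)" by (intro dig_val_sub[of _ k]) (simp add: subset_mset.less_imp_le)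
  have "?j < k" 
  proof -
    have "?j \<le> N (dig k)" using sub by (intro val_mono) (simp add: subset_mset.less_imp_le)
    moreover have "?j \<noteq> k" using Suc.prems(2) dj by auto
    ultimately show ?thesis by simp
  qed
  moreover have sim: "\<forall>s. Q dvd l s (G (Suc D)) - l s (dig k)" using Suc.prems by (simp add: chain_def)
  ultimately have desc: "descent k ?j" using sub dj by (auto simp: descent_def lv_diff_dvd_iff subset_mset.less_imp_le)
  have GG: "G D \<subset># G (Suc D)" using Suc.prems by (simp add: chain_def)
  have "chain (dig k) D G" using Suc.prems GG by (auto simp: chain_def intro: subset_mset.order_trans subset_mset.less_imp_le)
  moreover have "G D \<subseteq># dig ?j" using GG dj by (simp add: subset_mset.less_imp_le)
  ultimately have "chain (dig ?j) D G" using sim dj by (intro chain_base[of "dig ?j" "dig k"]) auto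
  moreover have "G D \<noteq> dig ?j" using GG dj by auto
  ultimately have IH: "descent ?j (N (G D)) \<and> (\<exists>m\<in>costs D (N (G D)). cost (\<lambda>_. 1) D G = N (G D) + m)"
    by (rule Suc.IH)
  then have "cost (\<lambda>_. 1) D G \<in> costs (Suc D) ?j" by auto
  then show ?case using desc by (auto simp: cost_Suc intro!: bexI[of _ "cost (\<lambda>_. 1) D G"])
qed

lemma costs_nonempty_imp:
  assumes "costs d k \<noteq> {}" shows "int d * Q \<le> l s (dig k)"
proof (cases d)
  case 0 then show ?thesis using l_nonneg by simp
next
  case (Suc D)
  then obtain j m where "descent k j" "m \<in> costs D j" using assms by auto
  then obtain G where G: "chain (dig k) D G" "G D = dig j" using costs_chain by blast
  have sub: "dig j \<subseteq># dig k" and ne: "dig j \<noteq> dig k" using \<open>descent k j\<close> by (auto simp: descent_def dig_inject)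
  have "dig k - dig j \<noteq> {#}" using sub ne by (simp add: Diff_eq_empty_iff_mset subset_mset.antisym_conv)
  then have "0 < l s (dig k - dig j)" by (rule l_pos)
  then have pos: "0 < l s (dig k) - l s (dig j)" using sub by simp
  have "Q dvd l s (dig j) - l s (dig k)" using G by (auto simp: chain_def)
  then have "Q dvd l s (dig k) - l s (dig j)" by (simp add: dvd_diff_commute)
  from zdvd_imp_le[OF this pos] have "l s (dig j) + Q \<le> l s (dig k)" by simp
  moreover have "th (dig k) s + int D * Q \<le> l s (dig j)" using chain_lower[OF G(1) order_refl, of s] G(2) by simp
  moreover have "0 \<le> th (dig k) s" using Q_pos by simp
  ultimately show ?thesis using Suc by (simp add: algebra_simps)
qed

text \<open>The assumed weight leaves one \<open>Q\<close> more than \<open>top_minimal\<close> asks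
  for, so \<open>dig k\<close> minus any one element is still a competitor, and it is smaller than
  \<open>dig k\<close>.\<close>

lemma optimal_proper:
  assumes F: "\<And>s. int (Suc D) * Q \<le> l s (dig k)"
    and G: "chain (dig k) D G" "\<And>H. chain (dig k) D H \<Longrightarrow> cost (\<lambda>_. 1) D G \<le> cost (\<lambda>_. 1) D H"
  shows "G D \<noteq> dig k"
proof -
  have "0 < l 0 (dig k)" using F[of 0] Q_pos mult_right_mono[of 1 "int (Suc D)" Q] by linarith
  then obtain x where x: "x \<in># dig k" by (metis lv_simps(1) less_irrefl multiset_nonemptyE)
  have "N (G D) \<le> N (dig k - {#x#})"
  proof (rule top_minimal[OF count_dig_less _ _ G])
    fix s
    \<comment> \<open>A multiple of \<open>Q\<close> not exceeding a number does not exceed that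
      number minus its residue, so the term \<open>th\<close> comes for free.\<close>
    have "int (Suc D) \<le> l s (dig k) div Q" by (rule le_div_Q) (rule F)
    then have "int (Suc D) * Q \<le> l s (dig k) div Q * Q" using Q_pos by (intro mult_right_mono) auto
    then have "th (dig k) s + int (Suc D) * Q \<le> l s (dig k)" 
      using div_mult_mod_eq[of "l s (dig k)" Q] by linarith
    then show "th (dig k) s + int D * Q \<le> l s (dig k - {#x#})"
      using x w_le[of s x] by (simp add: algebra_simps)
  qed auto
  also have "N (dig k - {#x#}) < N (dig k)"
  proof -
    have "N (dig k) = p ^ x + N (dig k - {#x#})" using x by (metis insert_DiffM val_simps(2))
    moreover have "0 < p ^ x" using p2 by simp
    ultimately show ?thesis by linarith
  qed
  finally show ?thesis by auto
qed

text \<open>Each of two optimal chains is a competitor for the other in \<open>top_minimal\<close>,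
  so their tops have equal value. Only the first member is compared here; the later ones are left to
  the induction in \<open>coeff_monic_power_sum_Inf\<close>.\<close>

lemma costs_unique:
  assumes F: "\<And>s. int (Suc D) * Q \<le> l s (dig k)"
  shows "costs (Suc D) k \<noteq> {}"
    and "descent k j1 \<Longrightarrow> m1 \<in> costs D j1 \<Longrightarrow> j1 + m1 = Inf (costs (Suc D) k) \<Longrightarrow>
         descent k j2 \<Longrightarrow> m2 \<in> costs D j2 \<Longrightarrow> j2 + m2 = Inf (costs (Suc D) k) \<Longrightarrow> j1 = j2"
proof -
  have "th (dig k) s + int D * Q \<le> l s (dig k)" for s
  proof -
    have "int (Suc D) \<le> l s (dig k) div Q" by (rule le_div_Q) (rule F)
    then have "int (Suc D) * Q \<le> l s (dig k) div Q * Q" using Q_pos by (intro mult_right_mono) auto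
    then have "th (dig k) s + int (Suc D) * Q \<le> l s (dig k)" 
      using div_mult_mod_eq[of "l s (dig k)" Q] by linarith
    then show ?thesis using Q_pos by (simp add: algebra_simps)
  qed
  then obtain G where "chain (dig k) D G" using chain_ext[of "dig k" "dig k" D] by auto
  then obtain G' where G': "chain (dig k) D G'" "\<And>H. chain (dig k) D H \<Longrightarrow> cost (\<lambda>_. 1) D G' \<le> cost (\<lambda>_. 1) D H"
    using ex_optimal by blast
  have "cost (\<lambda>_. 1) D G' \<in> costs (Suc D) k" using chain_costs[OF G'(1) optimal_proper[OF F G']] by auto
  then show ne: "costs (Suc D) k \<noteq> {}" by blast
  have inf: "Inf (costs (Suc D) k) \<le> cost (\<lambda>_. 1) D G'" using \<open>cost _ D G' \<in> _\<close> by (intro cInf_lower) auto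
  have *: "\<exists>G. chain (dig k) D G \<and> G D = dig j \<and> (\<forall>H. chain (dig k) D H \<longrightarrow> cost (\<lambda>_. 1) D G \<le> cost (\<lambda>_. 1) D H)"
    if "descent k j" "m \<in> costs D j" "j + m = Inf (costs (Suc D) k)" for j m
    using costs_chain[OF that(1,2)] that(3) inf G'(2) by (metis order_trans)
  assume "descent k j1" "m1 \<in> costs D j1" "j1 + m1 = Inf (costs (Suc D) k)"
  from *[OF this] obtain G1 where G1: "chain (dig k) D G1" "G1 D = dig j1" 
    "\<And>H. chain (dig k) D H \<Longrightarrow> cost (\<lambda>_. 1) D G1 \<le> cost (\<lambda>_. 1) D H" by blast
  assume "descent k j2" "m2 \<in> costs D j2" "j2 + m2 = Inf (costs (Suc D) k)"
  from *[OF this] obtain G2 where G2: "chain (dig k) D G2" "G2 D = dig j2" 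
    "\<And>H. chain (dig k) D H \<Longrightarrow> cost (\<lambda>_. 1) D G2 \<le> cost (\<lambda>_. 1) D H" by blast
  have le: "N (G1 D) \<le> N (G2 D)" 
    if "chain (dig k) D G1" "\<And>H. chain (dig k) D H \<Longrightarrow> cost (\<lambda>_. 1) D G1 \<le> cost (\<lambda>_. 1) D H" "chain (dig k) D G2" for G1 G2
  proof (rule top_minimal[OF count_dig_less _ _ that(1,2)])
    show "G2 D \<subseteq># dig k" using that(3) by (simp add: chain_def)
    show "th (dig k) s + int D * Q \<le> l s (G2 D)" for s by (rule chain_lower[OF that(3) order_refl])
  qed auto
  have "N (G1 D) \<le> N (G2 D)" by (rule le[OF G1(1,3) G2(1)])
  moreover have "N (G2 D) \<le> N (G1 D)" by (rule le[OF G2(1,3) G1(1)])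
  ultimately show "j1 = j2" using G1(2) G2(2) by simp
qed

text \<open>The omitted member exceeds the next one and is therefore positive, whence the strict
  decrease. A single member may be 0, so the order of vanishing need not grow from
  \<open>d = 0\<close> to \<open>d = 1\<close>.\<close>

lemma costs_drop:
  assumes "m \<in> costs (Suc (Suc d)) k" shows "\<exists>m'\<in>costs (Suc d) k. m' < m"
proof -
  have "m \<in> {j + n | j n. descent k j \<and> n \<in> costs (Suc d) j}" using assms by (simp only: costs.simps(2))
  then obtain j n where j: "descent k j" "n \<in> costs (Suc d) j" "m = j + n" by blast
  have "n \<in> {i + m' | i m'. descent j i \<and> m' \<in> costs d i}" using j(2) by (simp only: costs.simps(2))
  then obtain i m' where i: "descent j i" "m' \<in> costs d i" "n = i + m'" by blast
  have "descent k i" using j(1) i(1) by (rule descent_trans)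
  moreover have "n < m" using j i by (auto simp: descent_def)
  ultimately have "n \<in> costs (Suc d) k" "n < m" using i by auto
  then show ?thesis by blast
qed

lemma costs_drop_many:
  assumes "m \<in> costs d k" "Suc e < d" shows "\<exists>m'\<in>costs (Suc e) k. m' < m"
  using assms
proof (induction d arbitrary: m)
  case (Suc d)
  then obtain d' where d: "d = Suc d'" by (cases d) auto
  obtain m1 where m1: "m1 \<in> costs d k" "m1 < m" using costs_drop Suc.prems(1) unfolding d by blast
  show ?case
  proof (cases "Suc e = d")
    case True then show ?thesis using m1 by blast
  next
    case False
    then obtain m' where "m' \<in> costs (Suc e) k" "m' < m1" using Suc.IH[OF m1(1)] Suc.prems(2) by auto
    then show ?thesis using m1(2) by (intro bexI[of _ m']) auto
  qed
qed simp

end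

section \<open>Power sums of monic polynomials\<close>

lemma of_nat_card_eq_0: "of_nat (CARD('a::{ring_1,finite})) = (0::'a)"
proof -
  have "(\<Sum>x\<in>UNIV. x + 1) = (\<Sum>x\<in>UNIV. x :: 'a)"
    by (rule sum.reindex_bij_witness[of _ "\<lambda>x. x - 1" "\<lambda>x. x + 1"]) auto
  then show ?thesis by (simp add: sum.distrib)
qed

lemma CHAR_finite_field:
  assumes "prime p" "CARD('a::{field,finite}) = p ^ f"
  shows "CHAR('a) = p"
proof -
  have "CHAR('a) > 0" by (rule finite_imp_CHAR_pos) simp
  then have "prime CHAR('a)" by (rule prime_CHAR_semidom)
  moreover have "CHAR('a) dvd p ^ f" using of_nat_card_eq_0[where ?'a = 'a] assms(2) by (metis of_nat_eq_0_iff_char_dvd)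
  ultimately show ?thesis using assms(1) by (meson prime_dvd_power primes_dvd_imp_eq)
qed

lemma finite_field_power_card_minus_1:
  fixes x :: "'a::{field,finite}"
  assumes "x \<noteq> 0" shows "x ^ (CARD('a) - 1) = 1"
proof -
  let ?U = "UNIV - {0 :: 'a}"
  have "(\<Prod>y\<in>?U. x * y) = (\<Prod>y\<in>?U. y)"
    by (rule prod.reindex_bij_witness[of _ "\<lambda>y. y / x" "\<lambda>y. x * y"]) (use assms in auto)
  moreover have "(\<Prod>y\<in>?U. x * y) = x ^ card ?U * (\<Prod>y\<in>?U. y)" by (simp add: prod.distrib)
  moreover have "(\<Prod>y\<in>?U. y) \<noteq> 0" by (subst prod_zero_iff) auto
  ultimately show ?thesis by (simp add: card_Diff_singleton)
qed

text \<open>Otherwise all \<open>q - 1\<close> nonzero elements would be roots of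
  \<open>X^r - 1\<close>, where \<open>r = m mod (q - 1)\<close> is positive and smaller than
  \<open>q - 1\<close>.\<close>

lemma ex_power_neq_1:
  assumes "\<not> (CARD('a) - 1) dvd m"
  shows "\<exists>g::'a::{field,finite}. g \<noteq> 0 \<and> g ^ m \<noteq> 1"
proof (rule ccontr)
  assume a: "\<not> ?thesis"
  let ?Q = "CARD('a) - 1" and ?r = "m mod (CARD('a) - 1)"
  have "card {0, 1 :: 'a} \<le> CARD('a)" by (intro card_mono) auto
  then have Q: "0 < ?Q" by simp
  have r: "0 < ?r" "?r < ?Q" using assms Q by (auto simp: mod_greater_zero_iff_not_dvd)
  have root: "g ^ ?r = 1" if "g \<noteq> 0" for g :: 'a
  proof -
    have "g ^ m = g ^ (?Q * (m div ?Q) + ?r)" by simp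
    also have "\<dots> = (g ^ ?Q) ^ (m div ?Q) * g ^ ?r" by (simp only: power_add power_mult)
    also have "\<dots> = g ^ ?r" using finite_field_power_card_minus_1[OF that] by simp
    finally show ?thesis using a that by auto
  qed
  define P where "P = monom (1::'a) ?r - 1"
  have P0: "P \<noteq> 0"
  proof
    assume "P = 0"
    then have "coeff P ?r = 0" by simp
    then show False using r(1) by (simp add: P_def)
  qed
  have "degree P \<le> ?r" unfolding P_def by (intro degree_diff_le) (auto simp: degree_monom_le)
  moreover have "card {x. poly P x = 0} \<le> degree P" by (rule card_poly_roots_bound[OF P0])
  moreover have "UNIV - {0} \<subseteq> {x. poly P x = 0}" using root by (auto simp: P_def poly_monom)
  then have "card (UNIV - {0 :: 'a}) \<le> card {x. poly P x = 0}" by (intro card_mono) auto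
  ultimately show False using r(2) by (simp add: card_Diff_singleton)
qed

lemma sum_powers_finite_field:
  "(\<Sum>c\<in>UNIV. (c::'a::{field,finite}) ^ m) = (if 0 < m \<and> (CARD('a) - 1) dvd m then -1 else 0)"
proof -
  have card0: "of_nat (CARD('a)) = (0::'a)" 
    by (rule of_nat_card_eq_0)
  consider "m = 0" | "0 < m" "(CARD('a) - 1) dvd m" | "\<not> (CARD('a) - 1) dvd m" by auto
  then show ?thesis
  proof cases
    \<comment> \<open>Here \<open>0 ^ 0 = 1\<close>, so the sum is \<open>q = 0\<close>; this
      removes the term \<open>j = k\<close> from the recursion.\<close>
    case 1 then show ?thesis using card0 by simp
  next
    case 2
    then obtain n where n: "m = (CARD('a) - 1) * n" by auto
    have "c ^ m = (if c = 0 then 0 else 1)" for c :: 'a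
      using 2(1) finite_field_power_card_minus_1[of c] by (auto simp: n power_mult)
    then have "(\<Sum>c\<in>UNIV. (c::'a) ^ m) = (\<Sum>c\<in>UNIV. 1 - (if (c::'a) = 0 then 1 else 0))" 
      by (intro sum.cong) auto
    also have "\<dots> = of_nat (CARD('a)) - 1" by (subst sum_subtractf) simp
    finally show ?thesis using 2 card0 by simp
  next
    case 3
    then obtain g :: 'a where g: "g \<noteq> 0" "g ^ m \<noteq> 1" using ex_power_neq_1 by blast
    have "(\<Sum>c\<in>UNIV. (g * c) ^ m) = (\<Sum>c\<in>UNIV. c ^ m)"
      by (rule sum.reindex_bij_witness[of _ "\<lambda>y. y / g" "\<lambda>y. g * y"]) (use g in auto)
    then have "(g ^ m - 1) * (\<Sum>c\<in>UNIV. c ^ m) = 0"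
      by (simp add: power_mult_distrib sum_distrib_left[symmetric] left_diff_distrib)
    then show ?thesis using g 3 by simp
  qed
qed

section \<open>Binomial coefficients modulo \<open>p\<close>\<close>

lemma coeff_one_plus_X_power: "coeff ([:1, 1:] ^ n :: 'a::comm_semiring_1 poly) i = of_nat (n choose i)"
proof (cases "i \<le> n")
  case False
  have "degree ([:1, 1:] ^ n :: 'a poly) \<le> degree [:1, 1 :: 'a:] * n" by (rule degree_power_le)
  also have "\<dots> \<le> 1 * n" by (intro mult_right_mono) auto
  finally show ?thesis using False by (simp add: coeff_eq_0 binomial_eq_0)
qed (simp add: coeff_linear_poly_power)

text \<open>Write \<open>(1 + X)^(p n + a)\<close> as \<open>(1 + X^p)^n (1 + X)^a\<close> and
  compare coefficients: as \<open>a\<close> and \<open>b\<close> are below \<open>p\<close>, only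
  the power \<open>X^(p m)\<close> of the first factor contributes.\<close>

lemma of_nat_choose_digit:
  assumes p: "prime p" "CHAR('a::comm_ring_1) = p" and ab: "a < p" "b < p"
  shows "(of_nat ((p * n + a) choose (p * m + b)) :: 'a) = of_nat (n choose m) * of_nat (a choose b)"
proof -
  let ?X = "[:1, 1:] :: 'a poly"
  have "?X = monom 1 1 + 1" by (simp add: monom_altdef one_pCons)
  moreover have "(monom (1::'a) 1 + 1) ^ p = monom 1 1 ^ p + 1 ^ p"
    by (rule freshmans_dream) (simp_all add: p)
  ultimately have "?X ^ p = monom 1 1 ^ p + 1" by (simp only: power_one)
  then have Xp: "?X ^ p = monom 1 p + 1" by (simp add: monom_power)
  have "?X ^ (p * n + a) = (monom 1 p + 1) ^ n * ?X ^ a" by (simp only: power_add power_mult Xp)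
  also have "(monom 1 p + 1) ^ n = (\<Sum>i\<le>n. of_nat (n choose i) * monom (1::'a) (p * i))"
    by (subst binomial_ring) (simp add: monom_power mult.commute)
  finally have "coeff (?X ^ (p * n + a)) (p * m + b) = 
      (\<Sum>i\<le>n. of_nat (n choose i) * coeff (monom 1 (p * i) * ?X ^ a) (p * m + b))"
    by (simp add: sum_distrib_right coeff_sum mult.assoc of_nat_poly)
  also have "\<dots> = (\<Sum>i\<le>n. if i = m then of_nat (n choose m) * of_nat (a choose b) else 0)"
  proof (intro sum.cong refl)
    fix i
    consider "i < m" | "i = m" | "m < i" by linarith
    then show "of_nat (n choose i) * coeff (monom 1 (p * i) * ?X ^ a) (p * m + b) = 
         (if i = m then of_nat (n choose m) * of_nat (a choose b) else 0)"
    proof cases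
      case 1
      then have "p * (i + 1) \<le> p * m" by (intro mult_left_mono) auto
      then have "p * i \<le> p * m + b" "p * m + b - p * i \<ge> p" by auto
      moreover have "a choose (p * m + b - p * i) = 0" using ab calculation by (intro binomial_eq_0) simp
      ultimately show ?thesis using 1 by (simp add: coeff_monom_mult coeff_one_plus_X_power binomial_eq_0)
    next
      case 2 then show ?thesis by (simp add: coeff_monom_mult coeff_one_plus_X_power)
    next
      case 3
      then have "p * (m + 1) \<le> p * i" by (intro mult_left_mono) auto
      then show ?thesis using 3 ab by (simp add: coeff_monom_mult)
    qed
  qed
  also have "\<dots> = of_nat (n choose m) * of_nat (a choose b)" by (cases "m \<le> n") (auto simp: binomial_eq_0)
  finally show ?thesis by (simp add: coeff_one_plus_X_power)
qed

context base_pow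
begin

lemma dig_subset_iff: "dig j \<subseteq># dig k \<longleftrightarrow> (\<forall>e. j div p ^ e mod p \<le> k div p ^ e mod p)"
  by (simp add: subseteq_mset_def count_dig)

lemma dig_0: "dig 0 = {#}"
  by (rule multiset_eqI) (simp add: count_dig)

lemma dig_subset_rec: "dig j \<subseteq># dig k \<longleftrightarrow> j mod p \<le> k mod p \<and> dig (j div p) \<subseteq># dig (k div p)"
proof -
  have "(\<forall>e. j div p ^ e mod p \<le> k div p ^ e mod p) \<longleftrightarrow> 
      j mod p \<le> k mod p \<and> (\<forall>e. j div p ^ Suc e mod p \<le> k div p ^ Suc e mod p)"
    by (metis (no_types, lifting) div_by_1 not0_implies_Suc power_0)
  then show ?thesis by (simp add: dig_subset_iff div_mult2_eq)
qed

lemma lucas_choose: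
  assumes p: "prime p" "CHAR('a::field) = p"
  shows "of_nat (k choose j) \<noteq> (0::'a) \<longleftrightarrow> dig j \<subseteq># dig k"
proof (induction k arbitrary: j rule: less_induct)
  case (less k)
  show ?case
  proof (cases "k = 0")
    case True
    have "dig j = {#} \<longleftrightarrow> j = 0" by (metis dig_0 dig_inject)
    then show ?thesis using True by (cases j) (auto simp: dig_0)
  next
    case False
    then have IH: "of_nat (k div p choose j div p) \<noteq> (0::'a) \<longleftrightarrow> dig (j div p) \<subseteq># dig (k div p)"
      using p2 by (intro less.IH) auto
    have "of_nat ((p * (k div p) + k mod p) choose (p * (j div p) + j mod p)) = 
         (of_nat (k div p choose j div p) * of_nat (k mod p choose j mod p) :: 'a)"
      using p2 by (intro of_nat_choose_digit[OF p]) auto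
    then have eq: "of_nat (k choose j) = (of_nat (k div p choose j div p) * of_nat (k mod p choose j mod p) :: 'a)"
      by simp
    have "of_nat (k mod p choose j mod p) \<noteq> (0::'a) \<longleftrightarrow> j mod p \<le> k mod p"
    proof
      assume le: "j mod p \<le> k mod p"
      have "\<not> p dvd (k mod p choose j mod p)"
      proof
        assume "p dvd (k mod p choose j mod p)"
        then have "p dvd fact (k mod p)" using binomial_fact_lemma[OF le] by (metis dvd_mult)
        then have "p \<le> k mod p" using p(1) by (simp add: prime_dvd_fact_iff)
        then show False using p2 by (metis mod_less_divisor not_le pos2 order_less_le_trans)
      qed
      then show "of_nat (k mod p choose j mod p) \<noteq> (0::'a)" using p(2) by (simp add: of_nat_eq_0_iff_char_dvd)
    next
      assume "of_nat (k mod p choose j mod p) \<noteq> (0::'a)"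
      then show "j mod p \<le> k mod p" by (metis binomial_eq_0 not_le of_nat_0)
    qed
    then show ?thesis using IH eq dig_subset_rec[of j k] by auto
  qed
qed

end

section \<open>The recursion for power sums and its lowest coefficient\<close>

definition monic_power_sum :: "nat \<Rightarrow> nat \<Rightarrow> 'a::{field,finite} poly" where
  "monic_power_sum d k = (\<Sum>a\<in>monic_of_degree d. a ^ k)"

lemma monic_0: "monic_of_degree 0 = {1 :: 'a::field poly}"
proof -
  have "a = 1" if "lead_coeff a = 1" "degree a = 0" for a :: "'a poly"
    using that by (metis degree_0_id of_nat_1 one_poly_eq_simps(1) one_pCons)
  then show ?thesis by (auto simp: monic_of_degree_def)
qed

lemma monic_Suc: "monic_of_degree (Suc d) = (\<lambda>(c, b). pCons c b) ` (UNIV \<times> monic_of_degree d :: ('a::field \<times> 'a poly) set)"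
proof (intro equalityI subsetI)
  fix a :: "'a poly" assume a: "a \<in> monic_of_degree (Suc d)"
  obtain c b where cb: "a = pCons c b" by (cases a) auto
  have "b \<noteq> 0" using a cb by (auto simp: monic_of_degree_def)
  then have "b \<in> monic_of_degree d" using a cb unfolding monic_of_degree_def by auto
  then show "a \<in> (\<lambda>(c, b). pCons c b) ` (UNIV \<times> monic_of_degree d)" using cb by auto
next
  fix a :: "'a poly" assume "a \<in> (\<lambda>(c, b). pCons c b) ` (UNIV \<times> monic_of_degree d)"
  then obtain c b where cb: "a = pCons c b" "b \<in> monic_of_degree d" by auto
  then have "b \<noteq> 0" by (auto simp: monic_of_degree_def)
  then show "a \<in> monic_of_degree (Suc d)" using cb unfolding monic_of_degree_def mem_Collect_eq by (metis degree_pCons_eq lead_coeff_pCons(1))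
qed

lemma finite_monic [simp]: "finite (monic_of_degree d :: 'a::{field,finite} poly set)"
  by (induction d) (auto simp: monic_0 monic_Suc)

lemma monic_power_sum_0: "monic_power_sum 0 k = 1"
  by (simp add: monic_power_sum_def monic_0)

lemma monic_power_sum_Suc:
  "monic_power_sum (Suc d) k = (\<Sum>j\<le>k. [:\<Sum>c\<in>UNIV. (c::'a::{field,finite}) ^ (k - j):] * of_nat (k choose j) * (monom 1 j * monic_power_sum d j))"
proof -
  have inj: "inj_on (\<lambda>(c, b). pCons c b) (UNIV \<times> monic_of_degree d :: ('a \<times> 'a poly) set)" by (auto simp: inj_on_def)
  have exp: "pCons c b ^ k = (\<Sum>j\<le>k. of_nat (k choose j) * (monom 1 j * b ^ j) * [:c ^ (k - j):])" for c :: 'a and b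
  proof -
    have "pCons c b = monom 1 1 * b + [:c:]" by (simp add: monom_altdef)
    then show ?thesis by (simp only: binomial_ring power_mult_distrib monom_power) (simp add: poly_const_pow)
  qed
  have "monic_power_sum (Suc d) k = (\<Sum>(c :: 'a, b)\<in>UNIV \<times> monic_of_degree d. pCons c b ^ k)"
    using sum.reindex[OF inj, of "\<lambda>a. a ^ k"]
    by (simp only: monic_power_sum_def monic_Suc o_def) (simp add: case_prod_beta)
  also have "\<dots> = (\<Sum>c\<in>UNIV. \<Sum>b\<in>monic_of_degree d. \<Sum>j\<le>k. of_nat (k choose j) * (monom 1 j * b ^ j) * [:c ^ (k - j):])"
    by (simp only: sum.cartesian_product[symmetric] exp)
  also have "\<dots> = (\<Sum>c\<in>UNIV. \<Sum>j\<le>k. \<Sum>b\<in>monic_of_degree d. of_nat (k choose j) * (monom 1 j * b ^ j) * [:c ^ (k - j):])"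
    by (intro sum.cong refl sum.swap)
  also have "\<dots> = (\<Sum>j\<le>k. \<Sum>c\<in>UNIV. \<Sum>b\<in>monic_of_degree d. of_nat (k choose j) * (monom 1 j * b ^ j) * [:c ^ (k - j):])"
    by (rule sum.swap)
  also have "\<dots> = (\<Sum>j\<le>k. [:\<Sum>c\<in>UNIV. c ^ (k - j):] * of_nat (k choose j) * (monom 1 j * monic_power_sum d j))"
  proof (intro sum.cong refl)
    fix j
    have const: "[:\<Sum>c\<in>A. g c:] = (\<Sum>c\<in>A. [:g c:])" for g :: "'a \<Rightarrow> 'a" and A
      by (rule poly_eqI) (simp add: coeff_sum coeff_pCons split: nat.splits)
    have "(\<Sum>(c::'a)\<in>UNIV. \<Sum>b\<in>monic_of_degree d. of_nat (k choose j) * (monom 1 j * b ^ j) * [:c ^ (k - j):])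
       = (\<Sum>(c::'a)\<in>UNIV. [:c ^ (k - j):] * (of_nat (k choose j) * (monom 1 j * monic_power_sum d j)))"
      unfolding monic_power_sum_def sum_distrib_left by (simp only: mult_ac)
    also have "\<dots> = [:\<Sum>(c::'a)\<in>UNIV. c ^ (k - j):] * (of_nat (k choose j) * (monom 1 j * monic_power_sum d j))"
      by (simp only: const sum_distrib_right)
    finally show "(\<Sum>(c::'a)\<in>UNIV. \<Sum>b\<in>monic_of_degree d. of_nat (k choose j) * (monom 1 j * b ^ j) * [:c ^ (k - j):])
       = [:\<Sum>(c::'a)\<in>UNIV. c ^ (k - j):] * of_nat (k choose j) * (monom 1 j * monic_power_sum d j)" 
      by (simp only: mult.assoc)
  qed
  finally show ?thesis .
qed

lemma coeff_monic_power_sum_Suc: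
  "coeff (monic_power_sum (Suc d) k :: 'a::{field,finite} poly) n = 
   - (\<Sum>j | j < k \<and> (CARD('a) - 1) dvd (k - j) \<and> j \<le> n. of_nat (k choose j) * coeff (monic_power_sum d j) (n - j))"
proof -
  have "coeff (monic_power_sum (Suc d) k :: 'a poly) n = 
     (\<Sum>j\<le>k. (if j < k \<and> (CARD('a) - 1) dvd (k - j) \<and> j \<le> n then - (of_nat (k choose j) * coeff (monic_power_sum d j) (n - j)) else 0))"
    unfolding monic_power_sum_Suc coeff_sum
    by (intro sum.cong refl) (auto simp: sum_powers_finite_field of_nat_poly coeff_monom_mult)
  also have "\<dots> = (\<Sum>j | j < k \<and> (CARD('a) - 1) dvd (k - j) \<and> j \<le> n. - (of_nat (k choose j) * coeff (monic_power_sum d j) (n - j)))"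
    by (subst sum.inter_filter[symmetric]) (auto intro!: sum.cong)
  finally show ?thesis by (simp add: sum_negf)
qed

context base_pow
begin

lemma descent_iff:
  assumes "prime p" "CARD('a::{field,finite}) = p ^ f"
  shows "descent k j \<longleftrightarrow> j < k \<and> (CARD('a) - 1) dvd (k - j) \<and> of_nat (k choose j) \<noteq> (0::'a)"
proof -
  have Q: "Q = int (CARD('a) - 1)" using assms(2) p2 by (simp add: Q_def of_nat_diff)
  have "Q dvd int j - int k \<longleftrightarrow> (CARD('a) - 1) dvd (k - j)" if "j < k"
    using that unfolding Q by (metis dvd_diff_commute int_dvd_int_iff less_imp_le of_nat_diff)
  then show ?thesis using lucas_choose[OF assms(1) CHAR_finite_field[OF assms], of k j] by (auto simp: descent_def)
qed

lemma coeff_monic_power_sum_costs: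
  assumes "prime p" "CARD('a::{field,finite}) = p ^ f"
  shows "coeff (monic_power_sum d k :: 'a poly) n \<noteq> 0 \<Longrightarrow> n \<in> costs d k"
proof (induction d arbitrary: k n)
  case 0
  then show ?case by (cases n) (auto simp: monic_power_sum_0)
next
  case (Suc d)
  then obtain j where j: "j < k" "(CARD('a) - 1) dvd (k - j)" "j \<le> n"
      "of_nat (k choose j) * coeff (monic_power_sum d j) (n - j) \<noteq> (0::'a)"
    unfolding coeff_monic_power_sum_Suc neg_equal_0_iff_equal by (auto elim!: sum.not_neutral_contains_not_neutral)
  then have "descent k j" "n - j \<in> costs d j" using descent_iff[OF assms] Suc.IH by auto
  then show ?case using j(3) by (simp only: costs.simps mem_Collect_eq) (intro exI[of _ j] exI[of _ "n - j"], simp)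
qed

text \<open>Cancellation at the least exponent is excluded by \<open>costs_unique\<close>: only one
  \<open>j\<close> contributes. The remainder \<open>m\<close> is then least in
  \<open>costs d j\<close>, so the induction hypothesis applies to its coefficient.\<close>

lemma coeff_monic_power_sum_Inf:
  assumes "prime p" "CARD('a::{field,finite}) = p ^ f"
  shows "costs d k \<noteq> {} \<Longrightarrow> coeff (monic_power_sum d k :: 'a poly) (Inf (costs d k)) \<noteq> 0"
proof (induction d arbitrary: k)
  case 0
  then show ?case by (simp add: monic_power_sum_0)
next
  case (Suc d)
  let ?m = "Inf (costs (Suc d) k)"
  let ?A = "{j. j < k \<and> (CARD('a) - 1) dvd (k - j) \<and> j \<le> ?m}"
  let ?g = "\<lambda>j. of_nat (k choose j) * coeff (monic_power_sum d j :: 'a poly) (?m - j)"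
  have "?m \<in> costs (Suc d) k" using Suc.prems by (rule Inf_nat_def1)
  then have "?m \<in> {j + m | j m. descent k j \<and> m \<in> costs d j}" by (simp only: costs.simps)
  then obtain j m where jm: "descent k j" "m \<in> costs d j" "?m = j + m" by blast
  note F = costs_nonempty_imp[OF Suc.prems]
  have min: "m \<le> m'" if "m' \<in> costs d j" for m'
  proof -
    have "j + m' \<in> costs (Suc d) k" using jm(1) that by auto
    then have "?m \<le> j + m'" by (intro cInf_lower) auto
    then show ?thesis using jm(3) by simp
  qed
  have "Inf (costs d j) = m" using jm(2) min by (intro cInf_eq_minimum) auto
  then have nz: "coeff (monic_power_sum d j :: 'a poly) m \<noteq> 0" using Suc.IH[of j] jm(2) by auto
  have jA: "j \<in> ?A" "of_nat (k choose j) \<noteq> (0::'a)" using jm descent_iff[OF assms] by auto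
  have "sum ?g ?A = sum ?g {j}"
  proof (rule sum.mono_neutral_right)
    show "\<forall>i\<in>?A - {j}. ?g i = 0"
    proof (intro ballI, rule ccontr)
      fix i assume i: "i \<in> ?A - {j}" "?g i \<noteq> 0"
      then have d: "descent k i" using descent_iff[OF assms] by auto
      have c: "?m - i \<in> costs d i" by (rule coeff_monic_power_sum_costs[OF assms]) (use i in auto)
      have e: "i + (?m - i) = ?m" using i by simp
      have "i = j" by (rule costs_unique(2)[OF F d c e jm(1,2) jm(3)[symmetric]])
      then show False using i by simp
    qed
  qed (use jA in auto)
  then have "sum ?g ?A = of_nat (k choose j) * coeff (monic_power_sum d j) m" using jm(3) by simp
  then show ?case unfolding coeff_monic_power_sum_Suc using nz jA(2) by simp
qed

section \<open>Base-\<open>q\<close> digit sums and \<open>L_k\<close>\<close>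

lemma l_sum: "finite A \<Longrightarrow> l s (\<Sum>i\<in>A. F i) = (\<Sum>i\<in>A. l s (F i))"
  by (induction A rule: finite_induct) auto

text \<open>A base-\<open>q\<close> digit is a block of \<open>f\<close> base-\<open>p\<close>
  digits, and position \<open>e\<close> enters its block with the factor
  \<open>p ^ (e mod f)\<close>, the weight at index 0.\<close>

lemma digit_sum_eq: "int (digit_sum (p ^ f) n) = l 0 (dig n)"
proof -
  have rep: "l 0 (replicate_mset m e) = int m * w 0 e" for m e by (induction m) (auto simp: algebra_simps)
  have w0: "w 0 e = int (p ^ (e mod f))" for e by (simp add: wt_def nat_mod_as_int)
  have big: "n div p ^ e mod p = 0" if "n < e" for e
  proof -
    have "n < p ^ n" using p2 by (intro power_gt_expt) simp
    also have "\<dots> \<le> p ^ e" using that p2 by (intro power_increasing) auto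
    finally show ?thesis by simp
  qed
  have q: "n div (p ^ f) ^ i mod p ^ f = (\<Sum>e = i * f..<i * f + f. (n div p ^ e mod p) * p ^ (e mod f))" for i
  proof -
    have "n div (p ^ f) ^ i mod p ^ f = (\<Sum>j<f. (n div (p ^ f) ^ i div p ^ j mod p) * p ^ j)"
      by (rule digit_expansion[symmetric])
    also have "\<dots> = (\<Sum>j<f. (n div p ^ (j + i * f) mod p) * p ^ ((j + i * f) mod f))"
      by (intro sum.cong refl) (simp add: div_mult2_eq[symmetric] power_mult[symmetric] power_add mult.commute)
    also have "\<dots> = (\<Sum>e = i * f..<i * f + f. (n div p ^ e mod p) * p ^ (e mod f))"
      using sum.shift_bounds_nat_ivl[of "\<lambda>e. (n div p ^ e mod p) * p ^ (e mod f)" 0 "i * f" f]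
      by (simp add: atLeast0LessThan add.commute)
    finally show ?thesis .
  qed
  have "digit_sum (p ^ f) n = (\<Sum>i<Suc n. \<Sum>e = i * f..<i * f + f. (n div p ^ e mod p) * p ^ (e mod f))"
    unfolding digit_sum_def q lessThan_Suc_atMost ..
  also have "\<dots> = (\<Sum>e<Suc n * f. (n div p ^ e mod p) * p ^ (e mod f))" by (rule sum.nat_group)
  also have "\<dots> = (\<Sum>e\<le>n. (n div p ^ e mod p) * p ^ (e mod f))"
  proof (rule sum.mono_neutral_right)
    have "Suc n * 1 \<le> Suc n * f" using f0 by (intro mult_left_mono) auto
    then show "{..n} \<subseteq> {..<Suc n * f}" by auto
  qed (use big in auto)
  finally have "int (digit_sum (p ^ f) n) = (\<Sum>e\<le>n. int (n div p ^ e mod p) * w 0 e)"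
    by (simp add: w0)
  also have "\<dots> = l 0 (dig n)" by (simp add: dig_def l_sum rep)
  finally show ?thesis .
qed

lemma l_shift: "l 0 (image_mset (\<lambda>e. e + i) M) = l (int i) M"
  by (induction M) (auto simp: wt_def add.commute)

lemma dig_mult_power: "dig (k * p ^ i) = image_mset (\<lambda>e. e + i) (dig k)"
proof -
  let ?M = "image_mset (\<lambda>e. e + i) (dig k)"
  have "N (image_mset (\<lambda>e. e + i) M) = N M * p ^ i" for M
    by (induction M) (auto simp: power_add algebra_simps)
  then have "N ?M = k * p ^ i" by simp
  moreover have "count ?M e < p" for e
  proof (cases "\<exists>e'. e = e' + i")
    case True
    then obtain e' where "e = e' + i" by blast
    moreover have "count (image_mset (\<lambda>e. e + i) M) (e' + i) = count M e'" for M by (induction M) auto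
    ultimately have "count ?M e = count (dig k) e'" by simp
    then show ?thesis using count_dig_less by simp
  next
    case False
    then have "e \<notin># ?M" by auto
    then have "count ?M e = 0" by (simp only: not_in_iff)
    then show ?thesis using p2 by simp
  qed
  ultimately show ?thesis using dig_val[of ?M] by simp
qed

lemma L_bound_less_iff: "L_bound p f k < real n \<longleftrightarrow> (\<exists>i<f. l (int i) (dig k) < int n * Q)"
proof -
  have "L_bound p f k < real n \<longleftrightarrow> (\<exists>i\<in>{0..<f}. real (digit_sum (p ^ f) (k * p ^ i)) / (real (p ^ f) - 1) < real n)"
    unfolding L_bound_def using f0 by (subst Min_less_iff) auto
  also have "\<dots> \<longleftrightarrow> (\<exists>i<f. l (int i) (dig k) < int n * Q)"
  proof -
    have "real (digit_sum (p ^ f) (k * p ^ i)) / (real (p ^ f) - 1) < real n \<longleftrightarrow> l (int i) (dig k) < int n * Q" for i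
    proof -
      have d: "int (digit_sum (p ^ f) (k * p ^ i)) = l (int i) (dig k)"
        by (simp add: digit_sum_eq dig_mult_power l_shift)
      have Qr: "real (p ^ f) - 1 = real_of_int Q" by (simp add: Q_def)
      have "real (digit_sum (p ^ f) (k * p ^ i)) = real_of_int (l (int i) (dig k))" using d by (metis of_int_of_nat_eq)
      moreover have "0 < real_of_int Q" using Q_pos by simp
      ultimately have "real (digit_sum (p ^ f) (k * p ^ i)) / (real (p ^ f) - 1) < real n \<longleftrightarrow> 
          real_of_int (l (int i) (dig k)) < real_of_int (int n * Q)"
        unfolding Qr by (simp add: pos_divide_less_eq)
      then show ?thesis by (simp only: of_int_less_iff)
    qed
    then show ?thesis by auto
  qed
  finally show ?thesis .
qed

lemma costs_nonempty_iff: "costs n k \<noteq> {} \<longleftrightarrow> \<not> L_bound p f k < real n"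
proof
  assume "costs n k \<noteq> {}"
  then show "\<not> L_bound p f k < real n" using costs_nonempty_imp[of n k] unfolding L_bound_less_iff by (meson not_le)
next
  assume a: "\<not> L_bound p f k < real n"
  show "costs n k \<noteq> {}"
  proof (cases n)
    case (Suc D)
    have "int n * Q \<le> l s (dig k)" for s
    proof -
      have "nat (s mod int f) < f" using f0 by (simp add: nat_less_iff)
      then have "int n * Q \<le> l (int (nat (s mod int f))) (dig k)" using a unfolding L_bound_less_iff by (meson not_le)
      then have "int n * Q \<le> l (s mod int f) (dig k)" using f0 by simp
      then show ?thesis using l_mod[of "s mod int f" s] by simp
    qed
    then show ?thesis using costs_unique(1)[of D k] Suc by blast
  qed simp
qed

text \<open>A crude bound, whose purpose is that only finitely many tuples of degrees give nonzero
  terms.\<close>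

lemma costs_nonempty_le: "costs d k \<noteq> {} \<Longrightarrow> d \<le> nat (l 0 (dig k))"
proof -
  assume "costs d k \<noteq> {}"
  then have "int d * Q \<le> l 0 (dig k)" by (rule costs_nonempty_imp)
  moreover have "int d * 1 \<le> int d * Q" using Q_pos by (intro mult_left_mono) auto
  ultimately show ?thesis by linarith
qed

end

lemma coeff_mult_low:
  assumes "\<And>i. i < m \<Longrightarrow> coeff P i = 0" "\<And>i. i < n \<Longrightarrow> coeff R i = 0"
  shows "i < m + n \<Longrightarrow> coeff (P * R) i = (0::'a::comm_semiring_0)"
    and "coeff (P * R) (m + n) = coeff P m * coeff R n"
proof -
  assume "i < m + n"
  then have "coeff P j * coeff R (i - j) = 0" if "j \<le> i" for j
    using assms(1)[of j] assms(2)[of "i - j"] that by (cases "j < m") auto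
  then show "coeff (P * R) i = 0" unfolding coeff_mult by (intro sum.neutral) auto
next
  have "coeff (P * R) (m + n) = (\<Sum>i\<in>{m}. coeff P i * coeff R (m + n - i))" unfolding coeff_mult
  proof (rule sum.mono_neutral_right)
    show "\<forall>i\<in>{..m + n} - {m}. coeff P i * coeff R (m + n - i) = 0"
    proof
      fix i assume i: "i \<in> {..m + n} - {m}"
      show "coeff P i * coeff R (m + n - i) = 0"
        using i assms(1)[of i] assms(2)[of "m + n - i"] by (cases "i < m") auto
    qed
  qed auto
  then show "coeff (P * R) (m + n) = coeff P m * coeff R n" by simp
qed

text \<open>Here \<open>m j\<close> is any lower bound for the order of vanishing. One statement
  thus serves to isolate the lowest coefficient for one tuple of degrees and to show that the other
  tuples contribute nothing there.\<close>

lemma coeff_prod_low: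
  assumes "finite A" "\<And>j i. j \<in> A \<Longrightarrow> i < m j \<Longrightarrow> coeff (P j) i = 0"
  shows "(\<forall>i<sum m A. coeff (prod P A) i = (0::'a::comm_semiring_1)) \<and> coeff (prod P A) (sum m A) = (\<Prod>j\<in>A. coeff (P j) (m j))"
  using assms
proof (induction A rule: finite_induct)
  case (insert x A)
  then have IH: "\<And>i. i < sum m A \<Longrightarrow> coeff (prod P A) i = 0" "coeff (prod P A) (sum m A) = (\<Prod>j\<in>A. coeff (P j) (m j))"
    by auto
  have "\<And>i. i < m x \<Longrightarrow> coeff (P x) i = 0" using insert.prems by auto
  from coeff_mult_low[OF this IH(1)] show ?case using insert.hyps IH(2) by simp
qed simp

section \<open>Multizeta values\<close>

lemma poly_to_K_infty_0 [simp]: "poly_to_K_infty 0 = 0"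
  by (simp add: poly_to_K_infty_def)

lemma poly_to_K_infty_pCons: 
  "poly_to_K_infty (pCons c a) = fls_const c + fls_X_inv * poly_to_K_infty a"
  by (simp add: poly_to_K_infty_def map_poly_pCons)

lemma poly_to_K_infty_1 [simp]: "poly_to_K_infty 1 = 1"
  by (simp add: one_pCons poly_to_K_infty_pCons)

lemma poly_to_K_infty_add: "poly_to_K_infty (a + b) = poly_to_K_infty a + poly_to_K_infty b"
  by (induction a b rule: poly_induct2) (simp_all add: poly_to_K_infty_pCons fls_plus_const[symmetric] algebra_simps)

lemma poly_to_K_infty_smult: "poly_to_K_infty (smult c b) = fls_const c * poly_to_K_infty b"
  by (induction b) (simp_all add: poly_to_K_infty_pCons distrib_left fls_const_mult_const mult.left_commute)

lemma poly_to_K_infty_mult: "poly_to_K_infty (a * b) = poly_to_K_infty a * poly_to_K_infty b"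
  by (induction a) (simp_all add: poly_to_K_infty_pCons poly_to_K_infty_add poly_to_K_infty_smult distrib_right mult.assoc)

lemma poly_to_K_infty_power: "poly_to_K_infty (a ^ n) = poly_to_K_infty a ^ n"
  by (induction n) (simp_all add: poly_to_K_infty_mult)

lemma poly_to_K_infty_sum: "poly_to_K_infty (sum g A) = (\<Sum>x\<in>A. poly_to_K_infty (g x))"
  by (induction A rule: infinite_finite_induct) (simp_all add: poly_to_K_infty_add)

lemma poly_to_K_infty_prod: "poly_to_K_infty (prod g A) = (\<Prod>x\<in>A. poly_to_K_infty (g x))"
  by (induction A rule: infinite_finite_induct) (simp_all add: poly_to_K_infty_mult)

lemma fls_nth_poly_to_K_infty:
  "fls_nth (poly_to_K_infty a) m = (if m \<le> 0 then coeff a (nat (- m)) else 0)"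
proof (induction a arbitrary: m)
  case (pCons c a)
  have "fls_nth (fls_X_inv * poly_to_K_infty a) m = fls_nth (poly_to_K_infty a) (m + 1)"
    by (simp add: fls_X_inv_times_conv_shift)
  then show ?case using pCons.IH[of "m + 1"] 
    by (cases "m = 0") (auto simp: poly_to_K_infty_pCons coeff_pCons nat_diff_distrib split: nat.splits intro!: arg_cong[of _ _ "coeff a"])
qed simp

text \<open>Vanishing is thereby decided among polynomials, where the order at \<open>t = 0\<close>
  can be used although the topology of the completed field is the one at infinity.\<close>

lemma poly_to_K_infty_eq_0_iff: "poly_to_K_infty a = 0 \<longleftrightarrow> a = 0"
proof
  assume "poly_to_K_infty a = 0"
  then have "coeff a n = 0" for n using fls_nth_poly_to_K_infty[of a "- int n"] by simp
  then show "a = 0" by (intro poly_eqI) simp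
qed simp

lemma power_sum_eq: 
  assumes "s < 0" shows "power_sum d s = poly_to_K_infty (monic_power_sum d (nat (- s)))"
  using assms by (simp add: power_sum_def monic_power_sum_def poly_to_K_infty_sum poly_to_K_infty_power power_int_def)

lemma strictly_decreasing_lower:
  assumes "sorted_wrt (>) d" "j < length d" shows "length d - 1 - j \<le> d ! j"
proof -
  have "n \<le> d ! (length d - 1 - n)" if "n < length d" for n
    using that
  proof (induction n)
    case (Suc n)
    then have "d ! (length d - 1 - n) < d ! (length d - 1 - Suc n)"
      by (intro sorted_wrt_nth_less[OF assms(1)]) auto
    then show ?case using Suc by simp
  qed simp
  from this[of "length d - 1 - j"] show ?thesis using assms(2) by simp
qed

text \<open>If all entries before the last are least possible, the one before the last is 1, so the
  last is 0. The excess has to be found before the last place, because raising a degree from 0 need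
  not raise the order of vanishing.\<close>

lemma strictly_decreasing_ex_greater:
  assumes d: "sorted_wrt (>) d" "1 < length d" and ne: "d \<noteq> map (\<lambda>j. length d - 1 - j) [0..<length d]"
  shows "\<exists>j<length d - 1. length d - 1 - j < d ! j"
proof (rule ccontr)
  assume a: "\<not> ?thesis"
  let ?r = "length d"
  have eq: "d ! j = ?r - 1 - j" if "j < ?r - 1" for j
  proof -
    have "?r - 1 - j \<le> d ! j" using strictly_decreasing_lower[OF d(1), of j] that by simp
    moreover have "d ! j \<le> ?r - 1 - j" using a that by (meson not_le)
    ultimately show ?thesis by simp
  qed
  have "d ! (?r - 1) < d ! (?r - 2)" using d by (intro sorted_wrt_nth_less[OF d(1)]) auto
  then have "d ! (?r - 1) = 0" using eq[of "?r - 2"] d(2) by simp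
  then have "d ! j = ?r - 1 - j" if "j < ?r" for j using eq[of j] that by (cases "j = ?r - 1") auto
  then have "d = map (\<lambda>j. ?r - 1 - j) [0..<?r]" by (intro nth_equalityI) auto
  then show False using ne by simp
qed

lemma (in base_pow) multizeta_eq_sum:
  assumes p: "prime p" "CARD('a::{field,finite}) = p ^ f" and s: "\<forall>x\<in>set s. x < 0"
  defines "T \<equiv> \<lambda>d. \<Prod>j<length s. monic_power_sum (d ! j) (nat (- (s ! j))) :: 'a poly"
  shows "\<exists>E. finite E \<and> E \<subseteq> {d. length d = length s \<and> sorted_wrt (>) d} \<and> 
      (\<forall>d. length d = length s \<and> sorted_wrt (>) d \<and> T d \<noteq> 0 \<longrightarrow> d \<in> E) \<and>
      (multizeta s :: 'a fls) = poly_to_K_infty (\<Sum>d\<in>E. T d)"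
proof -
  let ?D = "{d. length d = length s \<and> sorted_wrt (>) d}"
  define B where "B = (\<Sum>j<length s. nat (l 0 (dig (nat (- (s ! j))))))"
  define E where "E = {d \<in> ?D. set d \<subseteq> {..B}}"
  have "finite {d. set d \<subseteq> {..B} \<and> length d = length s}" by (rule finite_lists_length_eq) simp
  then have fin: "finite E" by (rule rev_finite_subset) (auto simp: E_def)
  have E: "d \<in> E" if d: "d \<in> ?D" "T d \<noteq> 0" for d
  proof -
    have "x \<le> B" if "x \<in> set d" for x
    proof -
      obtain j where j: "j < length s" "x = d ! j" using \<open>x \<in> set d\<close> d(1) by (auto simp: in_set_conv_nth)
      have "monic_power_sum x (nat (- (s ! j))) \<noteq> (0 :: 'a poly)"
        using d(2) j by (auto simp: T_def)
      then obtain n where "coeff (monic_power_sum x (nat (- (s ! j))) :: 'a poly) n \<noteq> 0" by (meson leading_coeff_0_iff)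
      then have "costs x (nat (- (s ! j))) \<noteq> {}" using coeff_monic_power_sum_costs[OF p] by blast
      then have "x \<le> nat (l 0 (dig (nat (- (s ! j)))))" by (rule costs_nonempty_le)
      also have "\<dots> \<le> B" unfolding B_def using j(1) by (intro member_le_sum) auto
      finally show ?thesis .
    qed
    then show ?thesis using d by (auto simp: E_def)
  qed
  have eq: "(\<Prod>j<length s. power_sum (d ! j) (s ! j)) = poly_to_K_infty (T d)" for d
    unfolding T_def poly_to_K_infty_prod using s by (intro prod.cong refl power_sum_eq) auto
  have "(multizeta s :: 'a fls) = (\<Sum>\<^sub>\<infinity>d\<in>?D. poly_to_K_infty (T d))"
    unfolding multizeta_def eq ..
  also have "\<dots> = (\<Sum>\<^sub>\<infinity>d\<in>E. poly_to_K_infty (T d))"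
  proof (rule infsum_cong_neutral)
    fix d assume "d \<in> ?D - E"
    then have "T d = 0" using E by blast
    then show "poly_to_K_infty (T d) = 0" by simp
  qed (auto simp: E_def)
  also have "\<dots> = (\<Sum>d\<in>E. poly_to_K_infty (T d))" using fin by (rule infsum_finite)
  also have "\<dots> = poly_to_K_infty (\<Sum>d\<in>E. T d)" by (simp add: poly_to_K_infty_sum)
  finally show ?thesis using fin E by (intro exI[of _ E]) (auto simp: E_def)
qed

lemma (in base_pow) multizeta_eq_0_iff:
  fixes s :: "int list"
  assumes p: "prime p" "CARD('a::{field,finite}) = p ^ f" and r: "1 < length s" and s: "\<forall>x\<in>set s. x < 0"
  shows "(multizeta s :: 'a fls) = 0 \<longleftrightarrow> 
     (\<exists>i\<in>{1..length s - 1}. L_bound p f (nat (- (s ! (i - 1)))) < real (length s - i))"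
proof -
  let ?r = "length s"
  define k where "k j = nat (- (s ! j))" for j
  define T where "T d = (\<Prod>j<?r. monic_power_sum (d ! j) (k j) :: 'a poly)" for d
  obtain E where E: "finite E" "E \<subseteq> {d. length d = ?r \<and> sorted_wrt (>) d}"
    "\<And>d. length d = ?r \<Longrightarrow> sorted_wrt (>) d \<Longrightarrow> T d \<noteq> 0 \<Longrightarrow> d \<in> E"
    and mz: "(multizeta s :: 'a fls) = poly_to_K_infty (\<Sum>d\<in>E. T d)"
    using multizeta_eq_sum[OF p s] unfolding T_def k_def by blast
  have costs_triv: "(\<exists>i\<in>{1..?r - 1}. L_bound p f (k (i - 1)) < real (?r - i)) \<longleftrightarrow> (\<exists>j<?r. costs (?r - 1 - j) (k j) = {})"
  proof
    assume "\<exists>i\<in>{1..?r - 1}. L_bound p f (k (i - 1)) < real (?r - i)"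
    then obtain i where "i \<in> {1..?r - 1}" "costs (?r - i) (k (i - 1)) = {}" using costs_nonempty_iff by blast
    then show "\<exists>j<?r. costs (?r - 1 - j) (k j) = {}" by (intro exI[of _ "i - 1"]) auto
  next
    assume "\<exists>j<?r. costs (?r - 1 - j) (k j) = {}"
    then obtain j where j: "j < ?r" "costs (?r - 1 - j) (k j) = {}" by blast
    \<comment> \<open>The last place never fails, as \<open>costs 0\<close> is \<open>{0}\<close>;
      hence \<open>i = j + 1\<close> stays in the range up to \<open>r - 1\<close>.\<close>
    then have "j \<noteq> ?r - 1" by auto
    moreover have "L_bound p f (k j) < real (?r - 1 - j)" using j(2) costs_nonempty_iff by blast
    ultimately show "\<exists>i\<in>{1..?r - 1}. L_bound p f (k (i - 1)) < real (?r - i)"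
      using j(1) by (intro bexI[of _ "Suc j"]) auto
  qed
  \<comment> \<open>Chains are shortened from \<open>d ! j\<close> to \<open>r - 1 - j\<close>
    members, and each omission lowers the sum strictly. Only in the last place, where length 0 is
    reached, may equality occur.\<close>
  have lower: "\<exists>m'\<in>costs (?r - 1 - j) (k j). m' \<le> m \<and> (j < ?r - 1 \<and> ?r - 1 - j < d ! j \<longrightarrow> m' < m)"
    if d: "d \<in> E" and j: "j < ?r" and m: "m \<in> costs (d ! j) (k j)" for d j m
  proof -
    have "?r - 1 - j \<le> d ! j" using strictly_decreasing_lower[of d j] d j E(2) by auto
    then consider "?r - 1 - j = d ! j" | "?r - 1 - j = 0" | e where "?r - 1 - j = Suc e" "Suc e < d ! j"
      by (metis le_neq_implies_less not0_implies_Suc)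
    then show ?thesis
    proof cases
      case 1 then show ?thesis using m by auto
    next
      case 2 then show ?thesis using j by auto
    next
      case 3
      then obtain m' where "m' \<in> costs (Suc e) (k j)" "m' < m" using costs_drop_many m by blast
      then show ?thesis using 3(1) by (intro bexI[of _ m']) auto
    qed
  qed
  have "(\<Sum>d\<in>E. T d) = 0 \<longleftrightarrow> (\<exists>j<?r. costs (?r - 1 - j) (k j) = {})"
  proof
    assume "\<exists>j<?r. costs (?r - 1 - j) (k j) = {}"
    then obtain j where j: "j < ?r" "costs (?r - 1 - j) (k j) = {}" by blast
    have "T d = 0" if d: "d \<in> E" for d
    proof -
      have "costs (d ! j) (k j) = {}" using lower[OF d j(1)] j(2) by blast
      then have "coeff (monic_power_sum (d ! j) (k j) :: 'a poly) n = 0" for n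
        using coeff_monic_power_sum_costs[OF p] by blast
      then have "monic_power_sum (d ! j) (k j) = (0 :: 'a poly)" by (intro poly_eqI) simp
      then show ?thesis unfolding T_def using j(1) by (intro prod_zero) auto
    qed
    then show "(\<Sum>d\<in>E. T d) = 0" by simp
  next
    assume zero: "(\<Sum>d\<in>E. T d) = 0"
    show "\<exists>j<?r. costs (?r - 1 - j) (k j) = {}"
    proof (rule ccontr)
      assume "\<not> ?thesis"
      then have ne: "costs (?r - 1 - j) (k j) \<noteq> {}" if "j < ?r" for j using that by blast
      define V where "V j = Inf (costs (?r - 1 - j) (k j))" for j
      define d0 where "d0 = map (\<lambda>j. ?r - 1 - j) [0..<?r]"
      have low: "coeff (monic_power_sum (d ! j) (k j) :: 'a poly) i = 0"
        if d: "d \<in> E" and j: "j < ?r" and i: "i < V j + (if j < ?r - 1 \<and> ?r - 1 - j < d ! j then 1 else 0)" for d j i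
      proof (rule ccontr)
        assume "coeff (monic_power_sum (d ! j) (k j) :: 'a poly) i \<noteq> 0"
        then have "i \<in> costs (d ! j) (k j)" by (rule coeff_monic_power_sum_costs[OF p])
        from lower[OF d j this] obtain m' where m': "m' \<in> costs (?r - 1 - j) (k j)" "m' \<le> i" 
          "j < ?r - 1 \<and> ?r - 1 - j < d ! j \<longrightarrow> m' < i" by blast
        have "V j \<le> m'" unfolding V_def using m'(1) by (intro cInf_lower) auto
        then show False using m' i by (auto split: if_splits)
      qed
      have other: "coeff (T d) (\<Sum>j<?r. V j) = 0" if d: "d \<in> E" "d \<noteq> d0" for d
      proof -
        let ?m = "\<lambda>j. V j + (if j < ?r - 1 \<and> ?r - 1 - j < d ! j then 1 else 0)"
        have len: "length d = ?r" "sorted_wrt (>) d" using d E(2) by auto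
        obtain j where j: "j < ?r - 1" "?r - 1 - j < d ! j"
          using strictly_decreasing_ex_greater[OF len(2), unfolded len(1), OF r d(2)[unfolded d0_def]] by blast
        have "(\<Sum>j<?r. V j) < (\<Sum>j<?r. ?m j)"
        proof (rule sum_strict_mono_ex1)
          show "\<exists>a\<in>{..<?r}. V a < ?m a" using j by (intro bexI[of _ j]) auto
        qed auto
        then show ?thesis unfolding T_def 
          using coeff_prod_low[of "{..<?r}" ?m "\<lambda>j. monic_power_sum (d ! j) (k j) :: 'a poly"] low[OF d(1)] by auto
      qed
      have d0nth: "d0 ! j = ?r - 1 - j" if "j < ?r" for j using that by (simp add: d0_def)
      have lowest: "coeff (monic_power_sum (d0 ! j) (k j) :: 'a poly) i = 0" if "j < ?r" "i < V j" for j i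
      proof (rule ccontr)
        assume "coeff (monic_power_sum (d0 ! j) (k j) :: 'a poly) i \<noteq> 0"
        then have "i \<in> costs (?r - 1 - j) (k j)" using coeff_monic_power_sum_costs[OF p] d0nth[OF that(1)] by metis
        then have "V j \<le> i" unfolding V_def by (intro cInf_lower) auto
        then show False using that(2) by simp
      qed
      have "coeff (T d0) (\<Sum>j<?r. V j) = (\<Prod>j<?r. coeff (monic_power_sum (d0 ! j) (k j)) (V j))"
        unfolding T_def using coeff_prod_low[of "{..<?r}" V "\<lambda>j. monic_power_sum (d0 ! j) (k j) :: 'a poly"] lowest by auto
      moreover have "coeff (monic_power_sum (d0 ! j) (k j) :: 'a poly) (V j) \<noteq> 0" if "j < ?r" for j
        unfolding V_def d0nth[OF that] by (rule coeff_monic_power_sum_Inf[OF p ne[OF that]])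
      ultimately have nz: "coeff (T d0) (\<Sum>j<?r. V j) \<noteq> 0" by (simp add: prod_zero_iff)
      \<comment> \<open>\<open>E\<close> is only known to contain every tuple with a nonzero term,
        so membership of \<open>d0\<close> rests on \<open>nz\<close>.\<close>
      then have "T d0 \<noteq> 0" by auto
      moreover have "sorted_wrt (>) d0" by (auto simp: d0_def sorted_wrt_iff_nth_less)
      ultimately have "d0 \<in> E" by (intro E(3)) (auto simp: d0_def)
      then have "coeff (\<Sum>d\<in>E. T d) (\<Sum>j<?r. V j) = coeff (T d0) (\<Sum>j<?r. V j)"
        unfolding coeff_sum using E(1) other by (subst sum.remove[of _ d0]) auto
      then show False using zero nz by simp
    qed
  qed
  then show ?thesis unfolding mz poly_to_K_infty_eq_0_iff using costs_triv unfolding k_def by simp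
qed

theorem theorem2p10:
  fixes p f r :: nat and s :: "int list"
  assumes "prime p" and "f > 0" and "CARD('a::{field,finite}) = p ^ f"
    and "r > 1" and "length s = r" and "\<forall>x\<in>set s. x < 0"
  shows "((multizeta s :: 'a fls) = 0 \<longleftrightarrow> trivial_zero TYPE('a) p f s) \<and>
         ((multizeta s :: 'a fls) = 0 \<longleftrightarrow>
           (\<exists>i\<in>{1..r - 1}. real (r - i) > L_bound p f (nat (- (s ! (i - 1))))))"
proof -
  interpret base_pow p f using assms(1,2) by unfold_locales (simp_all add: prime_ge_2_nat)
  have "(multizeta s :: 'a fls) = 0 \<longleftrightarrow> (\<exists>i\<in>{1..r - 1}. real (r - i) > L_bound p f (nat (- (s ! (i - 1)))))"
    using multizeta_eq_0_iff[OF assms(1,3)] assms(4-6) by auto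
  then show ?thesis using assms(4-6) by (auto simp: trivial_zero_def)
qed

end
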